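(* Let $f(n)=O(n^{1-\varepsilon})$ for a constant $\varepsilon>0$. Consider the generalized matroidal degree-bounded spanning tree problem (GMDST): given an undirected graph $G=(V,E)$ with edge costs $c\in\mathbb{R}^E$, pairwise disjoint node sets $S_1,\dots,S_k\subseteq V$, and matroids $M_i=(\delta(S_i),\mathcal{I}_i)$, $i\in[k]$, find a minimum-cost spanning tree $T$ of $G$ with $T\cap\delta(S_i)\in\mathcal{I}_i$ for all $i\in[k]$. Suppose there is a polynomial-time algorithm that, for any feasible GMDST instance, returns a spanning tree $T\subseteq E$ such that $T\cap\delta(S_i)$ is $f(|E|)$-additively independent in $M_i$ for all $i\in[k]$. Then one can find a feasible solution to any feasible GMDST instance in polynomial time.
   Context: $\delta(S)$ is the set of edges with exactly one endpoint in $S$. A set $R$ is $\mu$-additively independent in a matroid with rank function $r$ if $|R|-r(R)\le\mu$, i.e., at most $\mu$ elements can be removed from $R$ to obtain an independent set. A feasible solution to GMDST is a spanning tree $T$ with $T\cap\delta(S_i)\in\mathcal{I}_i$ for all $i$. *)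

theory Defs
  imports
    Complex_Main
    "HOL-Library.Landau_Symbols"
    "HOL-Computational_Algebra.Polynomial"
begin

section \<open>Graphs and spanning trees\<close>

definition simple_graph :: "'v set \<Rightarrow> 'v set set \<Rightarrow> bool" where
  "simple_graph V E \<longleftrightarrow> finite V \<and> V \<noteq> {} \<and> (\<forall>e\<in>E. e \<subseteq> V \<and> card e = 2)"

definition connected_graph :: "'v set \<Rightarrow> 'v set set \<Rightarrow> bool" where
  "connected_graph V E \<longleftrightarrow> (\<forall>u\<in>V. \<forall>v\<in>V. (u, v) \<in> {(x, y). {x, y} \<in> E}\<^sup>*)"

text \<open>A cycle is given by the list of its pairwise distinct vertices in cyclic order.\<close>

definition is_cycle :: "'v set set \<Rightarrow> 'v list \<Rightarrow> bool" where
  "is_cycle E p \<longleftrightarrow> 3 \<le> length p \<and> distinct p \<and>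
     (\<forall>i<length p. {p ! i, p ! (Suc i mod length p)} \<in> E)"

definition acyclic_graph :: "'v set set \<Rightarrow> bool" where
  "acyclic_graph E \<longleftrightarrow> (\<nexists>p. is_cycle E p)"

definition spanning_tree :: "'v set \<Rightarrow> 'v set set \<Rightarrow> 'v set set \<Rightarrow> bool" where
  "spanning_tree V E T \<longleftrightarrow> T \<subseteq> E \<and> connected_graph V T \<and> acyclic_graph T"

definition cut :: "'v set set \<Rightarrow> 'v set \<Rightarrow> 'v set set" where
  "cut E S = {e \<in> E. card (e \<inter> S) = 1}"


section \<open>Matroids\<close>

definition matroid :: "'a set \<Rightarrow> 'a set set \<Rightarrow> bool" where
  "matroid A \<I> \<longleftrightarrow> finite A \<and> \<I> \<subseteq> Pow A \<and> {} \<in> \<I> \<and>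
     (\<forall>X\<in>\<I>. \<forall>Y\<subseteq>X. Y \<in> \<I>) \<and>
     (\<forall>X\<in>\<I>. \<forall>Y\<in>\<I>. card X < card Y \<longrightarrow> (\<exists>y\<in>Y - X. insert y X \<in> \<I>))"

definition rank :: "'a set set \<Rightarrow> 'a set \<Rightarrow> nat" where
  "rank \<I> R = Max (card ` {X \<in> \<I>. X \<subseteq> R})"

definition additively_independent :: "'a set set \<Rightarrow> real \<Rightarrow> 'a set \<Rightarrow> bool" where
  "additively_independent \<I> \<mu> R \<longleftrightarrow> real (card R) - real (rank \<I> R) \<le> \<mu>"


section \<open>The generalized matroidal degree-bounded spanning tree problem\<close>

text \<open>
  The index set of the node sets and matroids is \<open>{..<num M}\<close>; the fields \<open>node_set\<close> and
  \<open>indep\<close> are irrelevant outside it, as is \<open>cost\<close> outside \<open>edges\<close>.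
\<close>

record 'v gmdst =
  verts :: "'v set"
  edges :: "'v set set"
  cost :: "'v set \<Rightarrow> real"
  num :: nat
  node_set :: "nat \<Rightarrow> 'v set"
  indep :: "nat \<Rightarrow> 'v set set set"

definition delta :: "'v gmdst \<Rightarrow> nat \<Rightarrow> 'v set set" where
  "delta M i = cut (edges M) (node_set M i)"

definition gmdst_instance :: "'v gmdst \<Rightarrow> bool" where
  "gmdst_instance M \<longleftrightarrow>
     simple_graph (verts M) (edges M) \<and>
     (\<forall>i<num M. node_set M i \<subseteq> verts M) \<and>
     (\<forall>i<num M. \<forall>j<num M. i \<noteq> j \<longrightarrow> node_set M i \<inter> node_set M j = {}) \<and>
     (\<forall>i<num M. matroid (delta M i) (indep M i))"

definition feasible_solution :: "'v gmdst \<Rightarrow> 'v set set \<Rightarrow> bool" where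
  "feasible_solution M T \<longleftrightarrow>
     spanning_tree (verts M) (edges M) T \<and> (\<forall>i<num M. T \<inter> delta M i \<in> indep M i)"

definition feasible_instance :: "'v gmdst \<Rightarrow> bool" where
  "feasible_instance M \<longleftrightarrow> gmdst_instance M \<and> (\<exists>T. feasible_solution M T)"

definition approx_solution :: "(nat \<Rightarrow> real) \<Rightarrow> 'v gmdst \<Rightarrow> 'v set set \<Rightarrow> bool" where
  "approx_solution f M T \<longleftrightarrow>
     spanning_tree (verts M) (edges M) T \<and>
     (\<forall>i<num M. additively_independent (indep M i) (f (card (edges M))) (T \<inter> delta M i))"


section \<open>Algorithms with an oracle and their running time\<close>

text \<open>
  Algorithms are programs of a WHILE language whose variables hold finite binary trees, extended
  by a command that asks a yes/no oracle about a tree. Evaluating an expression costs the total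
  size of all values computed on the way. With this (logarithmic) cost measure all
  values occurring in a run, including the queries, are bounded in size by the running time (plus
  the size of the input), so that programs and oracle Turing machines simulate each other with
  polynomial overhead.
\<close>

datatype data = Atom | Pair data data

fun data_size :: "data \<Rightarrow> nat" where
  "data_size Atom = 1"
| "data_size (Pair a b) = Suc (data_size a + data_size b)"

fun first :: "data \<Rightarrow> data" where
  "first Atom = Atom"
| "first (Pair a b) = a"

fun second :: "data \<Rightarrow> data" where
  "second Atom = Atom"
| "second (Pair a b) = b"

definition bool_data :: "bool \<Rightarrow> data" where
  "bool_data b = (if b then Pair Atom Atom else Atom)"

datatype expr =
    Var nat
  | Const data
  | Cons_of expr expr
  | First expr
  | Second expr
  | Equal expr expr

type_synonym store = "nat \<Rightarrow> data"

fun eval_expr :: "expr \<Rightarrow> store \<Rightarrow> data" where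
  "eval_expr (Var x) s = s x"
| "eval_expr (Const d) s = d"
| "eval_expr (Cons_of a b) s = Pair (eval_expr a s) (eval_expr b s)"
| "eval_expr (First a) s = first (eval_expr a s)"
| "eval_expr (Second a) s = second (eval_expr a s)"
| "eval_expr (Equal a b) s = bool_data (eval_expr a s = eval_expr b s)"

fun expr_cost :: "expr \<Rightarrow> store \<Rightarrow> nat" where
  "expr_cost (Var x) s = data_size (s x)"
| "expr_cost (Const d) s = data_size d"
| "expr_cost (Cons_of a b) s = expr_cost a s + expr_cost b s + data_size (eval_expr (Cons_of a b) s)"
| "expr_cost (First a) s = expr_cost a s + data_size (eval_expr (First a) s)"
| "expr_cost (Second a) s = expr_cost a s + data_size (eval_expr (Second a) s)"
| "expr_cost (Equal a b) s = expr_cost a s + expr_cost b s + data_size (eval_expr (Equal a b) s)"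

datatype com =
    Skip
  | Assign nat expr
  | Query nat expr
  | Seq com com
  | If expr com com
  | While expr com

text \<open>
  \<open>run Q c s t s'\<close>: with oracle \<open>Q\<close>, command \<open>c\<close> started in store \<open>s\<close> halts in store \<open>s'\<close> after
  time \<open>t\<close>. In conditions \<open>Atom\<close> means false and every other value means true.
\<close>

inductive run :: "(data \<Rightarrow> bool) \<Rightarrow> com \<Rightarrow> store \<Rightarrow> nat \<Rightarrow> store \<Rightarrow> bool"
  for Q :: "data \<Rightarrow> bool" where
  Skip: "run Q Skip s 1 s"
| Assign: "run Q (Assign x e) s (Suc (expr_cost e s)) (s(x := eval_expr e s))"
| Query: "run Q (Query x e) s (Suc (expr_cost e s)) (s(x := bool_data (Q (eval_expr e s))))"
| Seq: "run Q c1 s t1 s' \<Longrightarrow> run Q c2 s' t2 s'' \<Longrightarrow> run Q (Seq c1 c2) s (t1 + t2) s''"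
| IfTrue: "eval_expr e s \<noteq> Atom \<Longrightarrow> run Q c1 s t s' \<Longrightarrow>
    run Q (If e c1 c2) s (Suc (expr_cost e s + t)) s'"
| IfFalse: "eval_expr e s = Atom \<Longrightarrow> run Q c2 s t s' \<Longrightarrow>
    run Q (If e c1 c2) s (Suc (expr_cost e s + t)) s'"
| WhileFalse: "eval_expr e s = Atom \<Longrightarrow> run Q (While e c) s (Suc (expr_cost e s)) s"
| WhileTrue: "eval_expr e s \<noteq> Atom \<Longrightarrow> run Q c s t1 s' \<Longrightarrow> run Q (While e c) s' t2 s'' \<Longrightarrow>
    run Q (While e c) s (Suc (expr_cost e s + t1 + t2)) s''"

inductive_cases run_SkipE: "run Q Skip s t s'"
inductive_cases run_AssignE: "run Q (Assign x e) s t s'"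
inductive_cases run_QueryE: "run Q (Query x e) s t s'"
inductive_cases run_SeqE: "run Q (Seq c1 c2) s t s'"
inductive_cases run_IfE: "run Q (If e c1 c2) s t s'"
inductive_cases run_WhileE: "run Q (While e c) s t s'"

lemma run_deterministic:
  "run Q c s t s' \<Longrightarrow> run Q c s u s'' \<Longrightarrow> u = t \<and> s'' = s'"
proof (induction arbitrary: u s'' rule: run.induct)
  case Skip
  then show ?case by (auto elim: run_SkipE)
next
  case Assign
  then show ?case by (auto elim: run_AssignE)
next
  case Query
  then show ?case by (auto elim: run_QueryE)
next
  case Seq
  from Seq.prems show ?case by (rule run_SeqE) (use Seq.IH in blast)
next
  case IfTrue
  from IfTrue.prems show ?case by (rule run_IfE) (use IfTrue in blast)+
next
  case IfFalse
  from IfFalse.prems show ?case by (rule run_IfE) (use IfFalse in blast)+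
next
  case WhileFalse
  from WhileFalse.prems show ?case by (rule run_WhileE) (use WhileFalse in blast)+
next
  case WhileTrue
  from WhileTrue.prems show ?case by (rule run_WhileE) (use WhileTrue.hyps WhileTrue.IH in blast)+
qed

text \<open>Input is passed in, and output is read off, variable 0.\<close>

definition initial_store :: "data \<Rightarrow> store" where
  "initial_store x = (\<lambda>_. Atom)(0 := x)"


section \<open>Encoding of instances\<close>

fun list_data :: "data list \<Rightarrow> data" where
  "list_data [] = Atom"
| "list_data (x # xs) = Pair x (list_data xs)"

definition nat_data :: "nat \<Rightarrow> data" where
  "nat_data n = list_data (replicate n Atom)"

text \<open>
  Nodes are named by arbitrary values of type \<^typ>\<open>data\<close>. An edge set is encoded by listing its
  members in some order, each as a pair of its endpoints in some order.
\<close>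

definition edge_set_code :: "data \<Rightarrow> data set set \<Rightarrow> bool" where
  "edge_set_code y T \<longleftrightarrow>
     (\<exists>ps. y = list_data (map (\<lambda>(u, v). Pair u v) ps) \<and> T = (\<lambda>(u, v). {u, v}) ` set ps)"

text \<open>
  A machine cannot read arbitrary real numbers, so the real edge costs are drawn from a set \<open>D\<close>
  of numbers with a finite representation \<open>enc\<close>, e.g. the rationals in binary.
\<close>

definition instance_code ::
  "real set \<Rightarrow> (real \<Rightarrow> data) \<Rightarrow> data \<Rightarrow> data gmdst \<Rightarrow> bool" where
  "instance_code D enc x M \<longleftrightarrow> cost M ` edges M \<subseteq> D \<and>
     (\<exists>vs ps ss.
        distinct vs \<and> set vs = verts M \<and>
        distinct (map (\<lambda>(u, v). {u, v}) ps) \<and> (\<lambda>(u, v). {u, v}) ` set ps = edges M \<and>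
        length ss = num M \<and> (\<forall>i<num M. distinct (ss ! i) \<and> set (ss ! i) = node_set M i) \<and>
        x = Pair (list_data vs)
              (Pair (list_data (map (\<lambda>(u, v). Pair (Pair u v) (enc (cost M {u, v}))) ps))
                    (list_data (map list_data ss))))"

text \<open>
  The matroids are accessible through independence oracles only: asked about an index \<open>i\<close> and a
  subset of the ground set of the \<open>i\<close>-th matroid, the oracle tells whether the subset is
  independent. Nothing is guaranteed about other queries.
\<close>

definition independence_oracle :: "data gmdst \<Rightarrow> (data \<Rightarrow> bool) \<Rightarrow> bool" where
  "independence_oracle M Q \<longleftrightarrow>
     (\<forall>i<num M. \<forall>R\<subseteq>delta M i. \<forall>y. edge_set_code y R \<longrightarrow> Q (Pair (nat_data i) y) = (R \<in> indep M i))"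

text \<open>
  There is a program which, on every encoding of a feasible instance and with every independence
  oracle for it, returns in time polynomial in the size of the encoding an edge set that
  satisfies \<open>good\<close>.
\<close>

definition polytime_on_feasible ::
  "real set \<Rightarrow> (real \<Rightarrow> data) \<Rightarrow> (data gmdst \<Rightarrow> data set set \<Rightarrow> bool) \<Rightarrow> bool" where
  "polytime_on_feasible D enc good \<longleftrightarrow>
     (\<exists>(c :: com) (p :: nat poly). \<forall>M x Q.
        feasible_instance M \<and> instance_code D enc x M \<and> independence_oracle M Q \<longrightarrow>
        (\<exists>t s T. run Q c (initial_store x) t s \<and> t \<le> poly p (data_size x) \<and>
                 edge_set_code (s 0) T \<and> good M T))"

end

theory Submission
  imports Defs
begin

text \<open>
  Glue \<open>N\<close> copies of the given instance together at one vertex, let the \<open>i\<close>-th node set of the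
  glued instance be the union of the copies of \<open>S\<^sub>i\<close>, and its matroid the direct sum of the copies
  of \<open>M\<^sub>i\<close>. A spanning tree of the glued graph restricts to a spanning tree of each copy, and the
  deficiency \<open>card R - rank R\<close> adds up over the copies. If the approximation algorithm violates each
  of the \<open>k\<close> matroids by at most \<open>f (N * card E)\<close>, at most \<open>k * f (N * card E)\<close> copies are infeasible;
  since \<open>f (n) = O(n\<^sup>1\<^sup>-\<^sup>\<epsilon>)\<close>, this is less than \<open>N\<close> for some \<open>N\<close> polynomial in \<open>card E\<close> and \<open>k\<close>, and
  then some copy is feasible. It is recognised with the independence oracle, which also
  answers the queries of the simulated algorithm about the direct sums.
\<close>

section \<open>Polynomial-time functions\<close>

text \<open>Merging the copies of a node set into one node set keeps the number of matroids at
  \<open>num M\<close>, so all copies share one error budget per matroid, and that budget grows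
  sublinearly in the number of copies. Gluing at a vertex keeps every edge inside one copy; this is
  why the cut of the union is the disjoint union of the cuts and why a spanning tree splits into
  spanning trees.

  On the machine side, polynomial time means an actual WHILE program. Functions on
  \<open>data\<close> are therefore shown to be computable through closure under composition,
  pairing, branching and one loop scheme whose accumulator grows additively. No arithmetic is
  performed: numbers are lengths of lists, and most list processing is expressed by
  \<open>flat_map\<close>. The oracle of the glued instance is not given but computed, so the
  algorithm runs with each query replaced by a subroutine. Encoded costs are copied without being
  decoded.\<close>

definition ispoly :: "(nat \<Rightarrow> nat) \<Rightarrow> bool" where
  "ispoly g \<longleftrightarrow> (\<exists>p :: nat poly. \<forall>n. g n = poly p n)"

lemma ispoly_const: "ispoly (\<lambda>n. k)"
  unfolding ispoly_def by (rule exI[of _ "[:k:]"]) simp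

lemma ispoly_id: "ispoly (\<lambda>n. n)"
  unfolding ispoly_def by (rule exI[of _ "[:0, 1:]"]) simp

lemma ispoly_add: "ispoly g \<Longrightarrow> ispoly h \<Longrightarrow> ispoly (\<lambda>n. g n + h n)"
  unfolding ispoly_def by (metis poly_add)

lemma ispoly_mult: "ispoly g \<Longrightarrow> ispoly h \<Longrightarrow> ispoly (\<lambda>n. g n * h n)"
  unfolding ispoly_def by (metis poly_mult)

lemma ispoly_poly: "ispoly g \<Longrightarrow> ispoly (\<lambda>n. poly p (g n))"
  unfolding ispoly_def by (metis poly_pcompose)

lemma ispoly_Suc: "ispoly g \<Longrightarrow> ispoly (\<lambda>n. Suc (g n))"
  using ispoly_add[OF ispoly_const[of 1]] by simp

lemmas ispoly_intros =
  ispoly_const ispoly_id ispoly_add ispoly_mult ispoly_poly ispoly_Suc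

lemma poly_nat_mono: "m \<le> n \<Longrightarrow> poly p m \<le> poly p n" for p :: "nat poly"
  by (induction p) (auto intro!: add_mono mult_mono)

section \<open>Total-correctness triples with a time bound, for a fixed start store\<close>

definition triple ::
  "(data \<Rightarrow> bool) \<Rightarrow> store \<Rightarrow> com \<Rightarrow> nat \<Rightarrow> (store \<Rightarrow> bool) \<Rightarrow> bool" where
  "triple Q s c n P \<longleftrightarrow> (\<exists>t s'. run Q c s t s' \<and> t \<le> n \<and> P s')"

lemma triple_weaken:
  "triple Q s c n P \<Longrightarrow> n \<le> m \<Longrightarrow> (\<And>s'. P s' \<Longrightarrow> R s') \<Longrightarrow> triple Q s c m R"
  unfolding triple_def by (meson le_trans)

lemma triple_Skip: "P s \<Longrightarrow> 1 \<le> n \<Longrightarrow> triple Q s Skip n P"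
  unfolding triple_def using run.Skip by blast

lemma triple_Assign:
  "P (s(x := eval_expr e s)) \<Longrightarrow> Suc (expr_cost e s) \<le> n \<Longrightarrow> triple Q s (Assign x e) n P"
  unfolding triple_def using run.Assign by blast

lemma triple_Query:
  "P (s(x := bool_data (Q (eval_expr e s)))) \<Longrightarrow> Suc (expr_cost e s) \<le> n \<Longrightarrow>
    triple Q s (Query x e) n P"
  unfolding triple_def using run.Query by blast

lemma triple_Seq:
  assumes "triple Q s c1 n1 R" and "\<And>s'. R s' \<Longrightarrow> triple Q s' c2 n2 P"
  shows "triple Q s (Seq c1 c2) (n1 + n2) P"
proof -
  obtain t1 s' where 1: "run Q c1 s t1 s'" "t1 \<le> n1" "R s'"
    using assms(1) unfolding triple_def by blast
  obtain t2 s'' where 2: "run Q c2 s' t2 s''" "t2 \<le> n2" "P s''"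
    using assms(2)[OF 1(3)] unfolding triple_def by blast
  show ?thesis
    unfolding triple_def using run.Seq[OF 1(1) 2(1)] 1(2) 2(2,3) by (meson add_mono)
qed

lemma triple_Assign_Seq:
  assumes "triple Q (s(x := eval_expr e s)) c n P" and "Suc (expr_cost e s) \<le> m"
  shows "triple Q s (Seq (Assign x e) c) (m + n) P"
  by (rule triple_Seq[where R = "\<lambda>s'. s' = s(x := eval_expr e s)"])
    (auto intro: triple_Assign assms)

lemma triple_If:
  assumes "eval_expr e s \<noteq> Atom \<Longrightarrow> triple Q s c1 n P"
    and "eval_expr e s = Atom \<Longrightarrow> triple Q s c2 n P"
  shows "triple Q s (If e c1 c2) (Suc (expr_cost e s + n)) P"
proof (cases "eval_expr e s = Atom")
  case True
  then show ?thesis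
    using assms(2) run.IfFalse[OF True] unfolding triple_def
    by (meson Suc_le_mono add_left_mono)
next
  case False
  then show ?thesis
    using assms(1) run.IfTrue[OF False] unfolding triple_def
    by (meson Suc_le_mono add_left_mono)
qed

lemma triple_While_False:
  "eval_expr e s = Atom \<Longrightarrow> P s \<Longrightarrow> Suc (expr_cost e s) \<le> n \<Longrightarrow> triple Q s (While e c) n P"
  unfolding triple_def using run.WhileFalse by blast

lemma triple_While_True:
  assumes "eval_expr e s \<noteq> Atom" and "triple Q s c n1 R"
    and "\<And>s'. R s' \<Longrightarrow> triple Q s' (While e c) n2 P"
  shows "triple Q s (While e c) (Suc (expr_cost e s + n1 + n2)) P"
proof -
  obtain t1 s' where 1: "run Q c s t1 s'" "t1 \<le> n1" "R s'"
    using assms(2) unfolding triple_def by blast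
  obtain t2 s'' where 2: "run Q (While e c) s' t2 s''" "t2 \<le> n2" "P s''"
    using assms(3)[OF 1(3)] unfolding triple_def by blast
  have "Suc (expr_cost e s + t1 + t2) \<le> Suc (expr_cost e s + n1 + n2)"
    using 1(2) 2(2) by simp
  then show ?thesis
    unfolding triple_def using run.WhileTrue[OF assms(1) 1(1) 2(1)] 2(3) by blast
qed

text \<open>
  A function is computed by a family of programs: the \<open>b\<close>-th one works in place on variable \<open>b\<close>
  and uses only variables from \<open>b\<close> on as scratch space, so that programs can be combined without
  renaming variables.
\<close>

definition computes ::
  "(nat \<Rightarrow> com) \<Rightarrow> nat poly \<Rightarrow> ((data \<Rightarrow> bool) \<Rightarrow> data \<Rightarrow> data) \<Rightarrow> bool" where
  "computes c p F \<longleftrightarrow> (\<forall>Q b s.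
     triple Q s (c b) (poly p (data_size (s b)))
       (\<lambda>s'. s' b = F Q (s b) \<and> (\<forall>v<b. s' v = s v)) \<and>
     data_size (F Q (s b)) \<le> poly p (data_size (s b)))"

definition polytime_fun :: "((data \<Rightarrow> bool) \<Rightarrow> data \<Rightarrow> data) \<Rightarrow> bool" where
  "polytime_fun F \<longleftrightarrow> (\<exists>c p. computes c p F)"

definition polytime_pred :: "((data \<Rightarrow> bool) \<Rightarrow> data \<Rightarrow> bool) \<Rightarrow> bool" where
  "polytime_pred B \<longleftrightarrow> polytime_fun (\<lambda>Q x. bool_data (B Q x))"

lemma polytime_funI:
  assumes "ispoly g"
    and "\<And>Q b s. triple Q s (c b) (g (data_size (s b)))
           (\<lambda>s'. s' b = F Q (s b) \<and> (\<forall>v<b. s' v = s v))"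
    and "\<And>Q x. data_size (F Q x) \<le> g (data_size x)"
  shows "polytime_fun F"
proof -
  obtain p where "\<And>n. g n = poly p n"
    using assms(1) unfolding ispoly_def by blast
  then have "computes c p F"
    using assms(2,3) unfolding computes_def by simp
  then show ?thesis
    unfolding polytime_fun_def by blast
qed

lemma computes_triple:
  assumes "computes c p F" and "data_size (s b) \<le> n"
    and "\<And>s'. s' b = F Q (s b) \<Longrightarrow> (\<And>v. v < b \<Longrightarrow> s' v = s v) \<Longrightarrow> P s'"
  shows "triple Q s (c b) (poly p n) P"
proof -
  have "triple Q s (c b) (poly p (data_size (s b)))
      (\<lambda>s'. s' b = F Q (s b) \<and> (\<forall>v<b. s' v = s v))"
    using assms(1) unfolding computes_def by blast
  then show ?thesis
    by (rule triple_weaken) (use assms(2,3) poly_nat_mono in auto)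
qed

lemma computes_size:
  assumes "computes c p F" and "data_size x \<le> n"
  shows "data_size (F Q x) \<le> poly p n"
proof -
  have "data_size (F Q x) \<le> poly p (data_size x)"
    using assms(1) unfolding computes_def by (metis fun_upd_same)
  then show ?thesis
    using poly_nat_mono[OF assms(2)] le_trans by blast
qed

lemma computes_Seq:
  assumes "computes c p F" and "data_size (s b) \<le> n"
    and "\<And>s'. s' b = F Q (s b) \<Longrightarrow> (\<And>v. v < b \<Longrightarrow> s' v = s v) \<Longrightarrow> triple Q s' d m P"
  shows "triple Q s (Seq (c b) d) (poly p n + m) P"
  by (rule triple_Seq[where R = "\<lambda>s'. s' b = F Q (s b) \<and> (\<forall>v<b. s' v = s v)"])
    (auto intro: assms(3) computes_triple[OF assms(1), of s b n, OF assms(2)])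

section \<open>Basic polynomial-time functions and their closure properties\<close>

lemma data_size_pos [simp]: "0 < data_size d"
  by (cases d) auto

lemma data_size_first: "data_size (first d) \<le> data_size d"
  by (cases d) auto

lemma data_size_second: "data_size (second d) \<le> data_size d"
  by (cases d) auto

lemma data_size_bool_data: "data_size (bool_data b) \<le> 3"
  by (simp add: bool_data_def)

lemma polytime_id: "polytime_fun (\<lambda>Q x. x)"
  by (rule polytime_funI[where g = "\<lambda>n. n + 1" and c = "\<lambda>b. Skip"])
    (auto intro!: ispoly_intros triple_Skip)

lemma polytime_const: "polytime_fun (\<lambda>Q x. d)"
  by (rule polytime_funI[where g = "\<lambda>n. Suc (data_size d)" and c = "\<lambda>b. Assign b (Const d)"])
    (auto intro!: ispoly_intros triple_Assign)

lemma polytime_comp: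
  assumes "polytime_fun F" and "polytime_fun G"
  shows "polytime_fun (\<lambda>Q x. F Q (G Q x))"
proof -
  obtain c p d q where F: "computes c p F" and G: "computes d q G"
    using assms unfolding polytime_fun_def by blast
  show ?thesis
  proof (rule polytime_funI[where g = "\<lambda>n. poly q n + poly p (poly q n)" and
        c = "\<lambda>b. Seq (d b) (c b)"])
    show "triple Q s (Seq (d b) (c b)) (poly q (data_size (s b)) + poly p (poly q (data_size (s b))))
        (\<lambda>s'. s' b = F Q (G Q (s b)) \<and> (\<forall>v<b. s' v = s v))" for Q b s
      by (rule computes_Seq[OF G order_refl], rule computes_triple[OF F])
        (auto intro: computes_size[OF G])
    show "data_size (F Q (G Q x)) \<le> poly q (data_size x) + poly p (poly q (data_size x))" for Q x
      using computes_size[OF F computes_size[OF G order_refl]] by (simp add: trans_le_add2)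
  qed (intro ispoly_intros)
qed

lemma polytime_Pair:
  assumes "polytime_fun F" and "polytime_fun G"
  shows "polytime_fun (\<lambda>Q x. Pair (F Q x) (G Q x))"
proof -
  obtain c p d q where F: "computes c p F" and G: "computes d q G"
    using assms unfolding polytime_fun_def by blast
  define g where "g = (\<lambda>n. Suc n + (poly p n + (Suc n + (poly q n + (4 * (poly p n + poly q n) + 2)))))"
  \<comment> \<open>Each component is computed on a fresh copy of the input: the program at
    \<open>b+1\<close> preserves \<open>b\<close>, and the one at \<open>b+2\<close> preserves the
    first result in \<open>b+1\<close>.\<close>
  let ?prog = "\<lambda>b. Seq (Assign (b+1) (Var b)) (Seq (c (b+1)) (Seq (Assign (b+2) (Var b))
        (Seq (d (b+2)) (Assign b (Cons_of (Var (b+1)) (Var (b+2)))))))"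
  show ?thesis
  proof (rule polytime_funI[where g = g and c = ?prog])
    show "ispoly g"
      unfolding g_def by (intro ispoly_intros)
    show "data_size (Pair (F Q x) (G Q x)) \<le> g (data_size x)" for Q x
      using computes_size[OF F order_refl, of Q x] computes_size[OF G order_refl, of Q x]
      unfolding g_def by simp
    fix Q :: "data \<Rightarrow> bool" and b :: nat and s :: store
    let ?n = "data_size (s b)"
    have sz: "data_size (F Q (s b)) \<le> poly p ?n" "data_size (G Q (s b)) \<le> poly q ?n"
      using computes_size[OF F order_refl, of Q "s b"] computes_size[OF G order_refl, of Q "s b"]
      by auto
    have last: "triple Q s3 (Assign b (Cons_of (Var (b+1)) (Var (b+2)))) (4 * (poly p ?n + poly q ?n) + 2)
        (\<lambda>s'. s' b = Pair (F Q (s b)) (G Q (s b)) \<and> (\<forall>v<b. s' v = s v))"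
      if "s3 (b+2) = G Q (s b)" "s3 (b+1) = F Q (s b)" "\<forall>v<b. s3 v = s v" for s3
      by (rule triple_Assign) (use that sz in auto)
    have mid: "triple Q s2 (Seq (Assign (b+2) (Var b))
        (Seq (d (b+2)) (Assign b (Cons_of (Var (b+1)) (Var (b+2))))))
        (Suc ?n + (poly q ?n + (4 * (poly p ?n + poly q ?n) + 2)))
        (\<lambda>s'. s' b = Pair (F Q (s b)) (G Q (s b)) \<and> (\<forall>v<b. s' v = s v))"
      if 2: "s2 (b+1) = F Q (s b)" "\<forall>v<b+1. s2 v = s v" for s2
    proof -
      have "triple Q (s2(b+2 := s2 b)) (Seq (d (b+2)) (Assign b (Cons_of (Var (b+1)) (Var (b+2)))))
        (poly q ?n + (4 * (poly p ?n + poly q ?n) + 2))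
        (\<lambda>s'. s' b = Pair (F Q (s b)) (G Q (s b)) \<and> (\<forall>v<b. s' v = s v))"
        by (rule computes_Seq[OF G], (use 2 in simp), rule last) (use 2 in auto)
      then show ?thesis
        by (intro triple_Assign_Seq) (use 2 in simp_all)
    qed
    have "triple Q (s(b+1 := s b)) (Seq (c (b+1)) (Seq (Assign (b+2) (Var b))
        (Seq (d (b+2)) (Assign b (Cons_of (Var (b+1)) (Var (b+2)))))))
        (poly p ?n + (Suc ?n + (poly q ?n + (4 * (poly p ?n + poly q ?n) + 2))))
        (\<lambda>s'. s' b = Pair (F Q (s b)) (G Q (s b)) \<and> (\<forall>v<b. s' v = s v))"
      by (rule computes_Seq[OF F], simp, rule mid) auto
    then show "triple Q s (?prog b) (g ?n)
        (\<lambda>s'. s' b = Pair (F Q (s b)) (G Q (s b)) \<and> (\<forall>v<b. s' v = s v))"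
      unfolding g_def by (intro triple_Assign_Seq) simp_all
  qed
qed

lemma polytime_first:
  assumes "polytime_fun F"
  shows "polytime_fun (\<lambda>Q x. first (F Q x))"
proof (rule polytime_comp[OF _ assms])
  show "polytime_fun (\<lambda>Q. first)"
  proof (rule polytime_funI[where g = "\<lambda>n. 2 * n + 1" and c = "\<lambda>b. Assign b (First (Var b))"])
    show "triple Q s (Assign b (First (Var b))) (2 * data_size (s b) + 1)
        (\<lambda>s'. s' b = first (s b) \<and> (\<forall>v<b. s' v = s v))" for Q b s
      using data_size_first[of "s b"] by (intro triple_Assign) auto
    show "data_size (first x) \<le> 2 * data_size x + 1" for x
      using data_size_first[of x] by linarith
  qed (intro ispoly_intros)
qed

lemma polytime_second:
  assumes "polytime_fun F"
  shows "polytime_fun (\<lambda>Q x. second (F Q x))"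
proof (rule polytime_comp[OF _ assms])
  show "polytime_fun (\<lambda>Q. second)"
  proof (rule polytime_funI[where g = "\<lambda>n. 2 * n + 1" and c = "\<lambda>b. Assign b (Second (Var b))"])
    show "triple Q s (Assign b (Second (Var b))) (2 * data_size (s b) + 1)
        (\<lambda>s'. s' b = second (s b) \<and> (\<forall>v<b. s' v = s v))" for Q b s
      using data_size_second[of "s b"] by (intro triple_Assign) auto
    show "data_size (second x) \<le> 2 * data_size x + 1" for x
      using data_size_second[of x] by linarith
  qed (intro ispoly_intros)
qed

lemma polytime_oracle:
  assumes "polytime_fun F"
  shows "polytime_pred (\<lambda>Q x. Q (F Q x))"
  unfolding polytime_pred_def
proof (rule polytime_comp[OF _ assms])
  show "polytime_fun (\<lambda>Q x. bool_data (Q x))"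
  proof (rule polytime_funI[where g = "\<lambda>n. n + 3" and c = "\<lambda>b. Query b (Var b)"])
    show "triple Q s (Query b (Var b)) (data_size (s b) + 3)
        (\<lambda>s'. s' b = bool_data (Q (s b)) \<and> (\<forall>v<b. s' v = s v))" for Q b s
      by (intro triple_Query) auto
    show "data_size (bool_data (Q x)) \<le> data_size x + 3" for Q x
      using data_size_bool_data[of "Q x"] by linarith
  qed (intro ispoly_intros)
qed

lemma polytime_eq:
  assumes "polytime_fun F" and "polytime_fun G"
  shows "polytime_pred (\<lambda>Q x. F Q x = G Q x)"
proof -
  \<comment> \<open>Comparing the two components of a single argument suffices; composition with
    pairing gives the rest.\<close>
  have "polytime_fun (\<lambda>Q x. bool_data (first x = second x))"
  proof (rule polytime_funI[where g = "\<lambda>n. 4 * n + 4" and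
        c = "\<lambda>b. Assign b (Equal (First (Var b)) (Second (Var b)))"])
    show "triple Q s (Assign b (Equal (First (Var b)) (Second (Var b)))) (4 * data_size (s b) + 4)
       (\<lambda>s'. s' b = bool_data (first (s b) = second (s b)) \<and> (\<forall>v<b. s' v = s v))" for Q b s
      using data_size_first[of "s b"] data_size_second[of "s b"]
        data_size_bool_data[of "first (s b) = second (s b)"]
      by (intro triple_Assign) simp_all
    show "data_size (bool_data (first x = second x)) \<le> 4 * data_size x + 4" for x
      using data_size_bool_data[of "first x = second x"] by linarith
  qed (intro ispoly_intros)
  from polytime_comp[OF this polytime_Pair[OF assms]] show ?thesis
    unfolding polytime_pred_def by simp
qed

lemma polytime_if:
  assumes "polytime_pred B" and "polytime_fun F" and "polytime_fun G"
  shows "polytime_fun (\<lambda>Q x. if B Q x then F Q x else G Q x)"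
proof -
  obtain a o' where B: "computes a o' (\<lambda>Q x. bool_data (B Q x))"
    using assms(1) unfolding polytime_fun_def polytime_pred_def by (elim exE)
  obtain c p d q where F: "computes c p F" and G: "computes d q G"
    using assms(2,3) unfolding polytime_fun_def by blast
  define g where "g = (\<lambda>n. Suc n + (poly o' n + Suc (3 + (poly p n + poly q n))))"
  \<comment> \<open>The test overwrites a copy in \<open>b+1\<close>, so either branch still finds
    the input in \<open>b\<close>.\<close>
  let ?prog = "\<lambda>b. Seq (Assign (b+1) (Var b)) (Seq (a (b+1)) (If (Var (b+1)) (c b) (d b)))"
  show ?thesis
  proof (rule polytime_funI[where g = g and c = ?prog])
    show "ispoly g"
      unfolding g_def by (intro ispoly_intros)
    show "data_size (if B Q x then F Q x else G Q x) \<le> g (data_size x)" for Q x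
      using computes_size[OF F order_refl, of Q x] computes_size[OF G order_refl, of Q x]
      unfolding g_def by simp
    fix Q :: "data \<Rightarrow> bool" and b :: nat and s :: store
    let ?n = "data_size (s b)"
    let ?P = "\<lambda>s'. s' b = (if B Q (s b) then F Q (s b) else G Q (s b)) \<and> (\<forall>v<b. s' v = s v)"
    have last: "triple Q s2 (If (Var (b+1)) (c b) (d b)) (Suc (3 + (poly p ?n + poly q ?n))) ?P"
      if 2: "s2 (b+1) = bool_data (B Q (s b))" "\<forall>v<b+1. s2 v = s v" for s2
    proof -
      have "triple Q s2 (c b) (poly p ?n + poly q ?n) ?P" if "B Q (s b)"
        by (rule triple_weaken[where n = "poly p ?n" and P = ?P], rule computes_triple[OF F])
          (use 2 that in auto)
      moreover have "triple Q s2 (d b) (poly p ?n + poly q ?n) ?P" if "\<not> B Q (s b)"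
        by (rule triple_weaken[where n = "poly q ?n" and P = ?P], rule computes_triple[OF G])
          (use 2 that in auto)
      ultimately have "triple Q s2 (If (Var (b+1)) (c b) (d b))
          (Suc (expr_cost (Var (b+1)) s2 + (poly p ?n + poly q ?n))) ?P"
        by (intro triple_If) (use 2 in \<open>auto simp: bool_data_def split: if_splits\<close>)
      then show ?thesis
        by (rule triple_weaken) (use 2 data_size_bool_data in auto)
    qed
    have "triple Q (s(b+1 := s b)) (Seq (a (b+1)) (If (Var (b+1)) (c b) (d b)))
        (poly o' ?n + Suc (3 + (poly p ?n + poly q ?n))) ?P"
      by (rule computes_Seq[OF B], simp, rule last) auto
    then show "triple Q s (?prog b) (g ?n) ?P"
      unfolding g_def by (intro triple_Assign_Seq) simp_all
  qed
qed

lemma polytime_not: "polytime_pred B \<Longrightarrow> polytime_pred (\<lambda>Q x. \<not> B Q x)"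
proof -
  assume "polytime_pred B"
  have "(\<lambda>Q x. bool_data (\<not> B Q x)) = (\<lambda>Q x. if B Q x then Atom else Pair Atom Atom)"
    by (intro ext) (simp add: bool_data_def)
  then show ?thesis
    using polytime_if[OF \<open>polytime_pred B\<close> polytime_const polytime_const]
    unfolding polytime_pred_def by simp
qed

text \<open>A left fold, except that \<open>f\<close> receives the whole remaining list instead of
  its head. The suffix itself can then name a copy, and the length of its tail can serve as an
  index.\<close>

fun loop :: "(data \<Rightarrow> data \<Rightarrow> data) \<Rightarrow> data \<Rightarrow> data \<Rightarrow> data" where
  "loop f Atom a = a"
| "loop f (Pair h t) a = loop f t (f (Pair h t) a)"

lemma loop_size:
  assumes "\<And>l a. data_size l \<le> n \<Longrightarrow> data_size (f l a) \<le> data_size a + k" and "data_size l \<le> n"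
  shows "data_size (loop f l a) \<le> data_size a + data_size l * k"
  using assms(2)
proof (induction l arbitrary: a)
  case (Pair h t)
  have "data_size (loop f t (f (Pair h t) a)) \<le> data_size (f (Pair h t) a) + data_size t * k"
    using Pair by auto
  also have "\<dots> \<le> data_size a + (1 + data_size t) * k"
    using assms(1)[OF Pair.prems, of a] by simp
  also have "\<dots> \<le> data_size a + data_size (Pair h t) * k"
    by (intro add_left_mono mult_right_mono) auto
  finally show ?case by simp
qed auto

text \<open>
  The growth of the accumulator in one round must not depend on its own size: otherwise it could
  double in every round.
\<close>

lemma polytime_loop:
  assumes F: "polytime_fun (\<lambda>Q e. F Q (first (first e)) (second (first e)) (second e))"
    and L: "polytime_fun L" and A: "polytime_fun A"
    and growth: "\<And>Q x l a. data_size (F Q x l a) \<le> data_size a + poly r (data_size x + data_size l)"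
  shows "polytime_fun (\<lambda>Q x. loop (F Q x) (L Q x) (A Q x))"
proof -
  have "polytime_fun (\<lambda>Q x. loop (F Q (first x)) (first (second x)) (second (second x)))"
  proof -
    obtain c p where c: "computes c p (\<lambda>Q e. F Q (first (first e)) (second (first e)) (second e))"
      using F unfolding polytime_fun_def by blast
    \<comment> \<open>For an input of size \<open>n\<close>, \<open>S\<close> bounds the accumulator
      throughout, \<open>W\<close> the time of one round including its test, and \<open>g\<close>
      the time of the whole program.\<close>
    define S where "S = (\<lambda>n. n + n * poly r (2 * n))"
    define W where "W = (\<lambda>n. 10 * (n + n + S n + 2) + poly p (n + n + S n + 2) + 2 * S n + 2 * n + 10)"
    define g where "g = (\<lambda>n. 9 * n + 9 + (Suc n * W n + (n + S n + 5)))"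
    \<comment> \<open>The fixed parameter stays in \<open>b\<close>, the remaining list in
      \<open>b+1\<close>, the accumulator in \<open>b+2\<close>; the round is evaluated in
      \<open>b+3\<close>.\<close>
    let ?body = "\<lambda>b. Seq (Assign (b+3) (Cons_of (Cons_of (Var b) (Var (b+1))) (Var (b+2))))
      (Seq (c (b+3)) (Seq (Assign (b+2) (Var (b+3))) (Assign (b+1) (Second (Var (b+1))))))"
    let ?prog = "\<lambda>b. Seq (Assign (b+1) (First (Second (Var b))))
      (Seq (Assign (b+2) (Second (Second (Var b)))) (Seq (Assign b (First (Var b)))
      (Seq (While (Var (b+1)) (?body b)) (Assign b (Var (b+2))))))"
    \<comment> \<open>The budget \<open>S n\<close> covers the accumulator together with the growth
      \<open>poly r (2 * n)\<close> still allowed for each unit of size of the remaining list. A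
      round moves part of this reserve into the accumulator, so the invariant survives.\<close>
    have W: "triple Q s (While (Var (b+1)) (?body b)) (Suc (data_size (s (b+1))) * W n)
        (\<lambda>s'. s' (b+2) = loop (F Q (s b)) (s (b+1)) (s (b+2)) \<and> (\<forall>v<b. s' v = s v))"
      if "data_size (s b) \<le> n" "data_size (s (b+1)) \<le> n"
        "data_size (s (b+2)) + data_size (s (b+1)) * poly r (2 * n) \<le> S n" for Q s b n
      using that
    proof (induction "s (b+1)" arbitrary: s)
      case Atom
      show ?case
        by (rule triple_While_False) (use Atom in \<open>auto simp: W_def\<close>)
    next
      case (Pair h t)
      let ?l = "Pair h t"
      let ?a = "s (b+2)"
      let ?a' = "F Q (s b) ?l ?a"
      let ?s1 = "s(b+3 := Pair (Pair (s b) ?l) ?a)"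
      note l = Pair.hyps(3)[symmetric]
      have sa: "data_size ?a \<le> S n" and sl: "data_size ?l \<le> n" and sx: "data_size (s b) \<le> n"
        using Pair.prems l by auto
      have "poly r (data_size (s b) + data_size ?l) \<le> poly r (2 * n)"
        by (rule poly_nat_mono) (use sl sx in simp)
      then have ga: "data_size ?a' \<le> data_size ?a + poly r (2 * n)"
        using growth[of Q "s b" ?l ?a] by linarith
      have "(1 + data_size t) * poly r (2 * n) \<le> data_size ?l * poly r (2 * n)"
        by (rule mult_right_mono) auto
      then have S': "data_size ?a' + data_size t * poly r (2 * n) \<le> S n"
        using ga Pair.prems(3) unfolding l add_mult_distrib by linarith
      have e: "data_size (?s1 (b+3)) \<le> n + n + S n + 2"
        using sa sl sx by simp
      let ?R = "\<lambda>s'. s' b = s b \<and> s' (b+1) = t \<and> s' (b+2) = ?a' \<and> (\<forall>v<b. s' v = s v)"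
      have last: "triple Q s2 (Seq (Assign (b+2) (Var (b+3))) (Assign (b+1) (Second (Var (b+1)))))
          (Suc (S n) + Suc (2 * n)) ?R"
        if 2: "s2 (b+3) = ?a'" "\<And>v. v < b+3 \<Longrightarrow> s2 v = s v" for s2
      proof -
        have "triple Q (s2(b+2 := ?a')) (Assign (b+1) (Second (Var (b+1)))) (Suc (2 * n)) ?R"
          by (rule triple_Assign) (use 2 l sl in auto)
        then have "triple Q s2 (Seq (Assign (b+2) (Var (b+3))) (Assign (b+1) (Second (Var (b+1)))))
            (Suc (data_size ?a') + Suc (2 * n)) ?R"
          by (intro triple_Assign_Seq) (use 2(1) in simp_all)
        then show ?thesis
          by (rule triple_weaken) (use S' in auto)
      qed
      have "triple Q ?s1 (Seq (c (b+3)) (Seq (Assign (b+2) (Var (b+3))) (Assign (b+1) (Second (Var (b+1))))))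
          (poly p (n + n + S n + 2) + (Suc (S n) + Suc (2 * n))) ?R"
        by (rule computes_Seq[OF c], rule e, rule last) auto
      then have body: "triple Q s (?body b)
          (Suc (expr_cost (Cons_of (Cons_of (Var b) (Var (b+1))) (Var (b+2))) s) +
           (poly p (n + n + S n + 2) + (Suc (S n) + Suc (2 * n)))) ?R"
        by (intro triple_Assign_Seq) (use l in simp_all)
      have rest: "triple Q s' (While (Var (b+1)) (?body b)) (Suc (data_size t) * W n)
          (\<lambda>s'. s' (b+2) = loop (F Q (s b)) (s (b+1)) (s (b+2)) \<and> (\<forall>v<b. s' v = s v))"
        if "?R s'" for s'
        by (rule triple_weaken[OF Pair.hyps(2)[of s']])
          (use that S' sl sx l in auto)
      show ?case
      proof (rule triple_weaken[OF triple_While_True[OF _ body rest]])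
        have "Suc (expr_cost (Var (b+1)) s + (Suc (expr_cost (Cons_of (Cons_of (Var b) (Var (b+1))) (Var (b+2))) s) +
           (poly p (n + n + S n + 2) + (Suc (S n) + Suc (2 * n))))) \<le> W n"
          using sa sl sx l by (simp add: W_def)
        then have "Suc (expr_cost (Var (b+1)) s + (Suc (expr_cost (Cons_of (Cons_of (Var b) (Var (b+1))) (Var (b+2))) s) +
           (poly p (n + n + S n + 2) + (Suc (S n) + Suc (2 * n)))) + Suc (data_size t) * W n)
           \<le> W n + Suc (data_size t) * W n" by linarith
        also have "\<dots> = (2 + data_size t) * W n" by simp
        also have "\<dots> \<le> Suc (data_size (s (b+1))) * W n"
          by (rule mult_right_mono) (use l in simp_all)
        finally show "Suc (expr_cost (Var (b+1)) s + (Suc (expr_cost (Cons_of (Cons_of (Var b) (Var (b+1))) (Var (b+2))) s) +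
           (poly p (n + n + S n + 2) + (Suc (S n) + Suc (2 * n)))) + Suc (data_size t) * W n)
           \<le> Suc (data_size (s (b+1))) * W n" .
      qed (use l in auto)
    qed
    have size: "data_size (loop (F Q (first x)) (first (second x)) (second (second x))) \<le> S (data_size x)"
      for Q x
    proof -
      let ?n = "data_size x"
      have le: "data_size (first x) \<le> ?n" "data_size (first (second x)) \<le> ?n" "data_size (second (second x)) \<le> ?n"
        using data_size_first data_size_second le_trans by blast+
      have "data_size (F Q (first x) l a) \<le> data_size a + poly r (2 * ?n)" if "data_size l \<le> ?n" for l a
        using growth[of Q "first x" l a] poly_nat_mono[of "data_size (first x) + data_size l" "2 * ?n" r] that le
        by linarith
      from loop_size[of ?n, OF this le(2)]
      have "data_size (loop (F Q (first x)) (first (second x)) (second (second x)))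
        \<le> data_size (second (second x)) + data_size (first (second x)) * poly r (2 * ?n)" .
      also have "\<dots> \<le> S ?n"
        unfolding S_def by (intro add_mono mult_right_mono le) auto
      finally show ?thesis .
    qed
    show ?thesis
    proof (rule polytime_funI[where g = g and c = ?prog])
      show "ispoly g"
        unfolding g_def S_def W_def by (intro ispoly_intros)
      show "data_size (loop (F Q (first x)) (first (second x)) (second (second x))) \<le> g (data_size x)" for Q x
        using size[of Q x] unfolding g_def by simp
      fix Q :: "data \<Rightarrow> bool" and b :: nat and s :: store
      let ?x = "s b"
      let ?n = "data_size ?x"
      let ?P = "\<lambda>s'. s' b = loop (F Q (first ?x)) (first (second ?x)) (second (second ?x)) \<and> (\<forall>v<b. s' v = s v)"
      define s3 where "s3 = s(b+1 := first (second ?x), b+2 := second (second ?x), b := first ?x)"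
      have le: "data_size (first ?x) \<le> ?n" "data_size (second ?x) \<le> ?n"
          "data_size (first (second ?x)) \<le> ?n" "data_size (second (second ?x)) \<le> ?n"
        using data_size_first data_size_second le_trans by blast+
      have last: "triple Q s4 (Assign b (Var (b+2))) (S ?n + 1) ?P"
        if "s4 (b+2) = loop (F Q (s3 b)) (s3 (b+1)) (s3 (b+2)) \<and> (\<forall>v<b. s4 v = s3 v)" for s4
        by (rule triple_Assign) (use that size[of Q ?x] in \<open>auto simp: s3_def\<close>)
      have "triple Q s3 (While (Var (b+1)) (?body b)) (Suc (data_size (s3 (b+1))) * W ?n)
        (\<lambda>s'. s' (b+2) = loop (F Q (s3 b)) (s3 (b+1)) (s3 (b+2)) \<and> (\<forall>v<b. s' v = s3 v))"
        by (rule W) (use le in \<open>auto simp: s3_def S_def intro!: add_mono mult_right_mono\<close>)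
      from triple_Seq[OF this last]
      have "triple Q s3 (Seq (While (Var (b+1)) (?body b)) (Assign b (Var (b+2))))
        (Suc (data_size (s3 (b+1))) * W ?n + (S ?n + 1)) ?P" by simp
      then have "triple Q s (?prog b) (Suc (expr_cost (First (Second (Var b))) s) + (Suc (expr_cost (Second (Second (Var b))) s)
         + (Suc (expr_cost (First (Var b)) s) + (Suc (data_size (s3 (b+1))) * W ?n + (S ?n + 1))))) ?P"
        by (intro triple_Assign_Seq) (simp_all add: s3_def)
      then show "triple Q s (?prog b) (g ?n) ?P"
      proof (rule triple_weaken)
        have "Suc (data_size (s3 (b+1))) * W ?n \<le> Suc ?n * W ?n"
          by (rule mult_right_mono) (use le in \<open>auto simp: s3_def\<close>)
        then show "Suc (expr_cost (First (Second (Var b))) s) + (Suc (expr_cost (Second (Second (Var b))) s)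
         + (Suc (expr_cost (First (Var b)) s) + (Suc (data_size (s3 (b+1))) * W ?n + (S ?n + 1)))) \<le> g ?n"
          using le unfolding g_def expr_cost.simps eval_expr.simps by linarith
      qed
    qed
  qed
  from polytime_comp[OF this polytime_Pair[OF polytime_id polytime_Pair[OF L A]]]
  show ?thesis by simp
qed

section \<open>Lists as data\<close>

fun elems :: "data \<Rightarrow> data list" where
  "elems Atom = []"
| "elems (Pair h t) = h # elems t"

text \<open>
  The non-empty suffixes of a list are pairwise distinct, whatever its entries are; this makes
  them usable as names for the copies of an instance.
\<close>

fun suffixes :: "data \<Rightarrow> data list" where
  "suffixes Atom = []"
| "suffixes (Pair h t) = Pair h t # suffixes t"

lemma elems_list_data [simp]: "elems (list_data xs) = xs"
  by (induction xs) auto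

lemma list_data_elems [simp]: "list_data (elems d) = d"
  by (induction d) auto

lemma elems_eq_Nil_iff [simp]: "elems d = [] \<longleftrightarrow> d = Atom"
  by (cases d) auto

lemma data_size_eq: "data_size d = Suc (\<Sum>x\<leftarrow>elems d. Suc (data_size x))"
  by (induction d) auto

lemma map_first_suffixes: "map first (suffixes d) = elems d"
  by (induction d) auto

lemma length_suffixes [simp]: "length (suffixes d) = length (elems d)"
  by (induction d) auto

text \<open>No suffix of the tail is larger than the tail, hence none equals the full list.\<close>

lemma distinct_suffixes: "distinct (suffixes d)"
proof -
  have "l \<in> set (suffixes d) \<Longrightarrow> data_size l \<le> data_size d" for l d
    by (induction d) auto
  then show ?thesis
    by (induction d) fastforce+
qed

text \<open>Pushing onto an accumulator reverses the order, so \<open>append_data\<close> reverses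
  its first argument beforehand.\<close>

definition rev_data :: "data \<Rightarrow> data" where
  "rev_data d = loop (\<lambda>l a. Pair (first l) a) d Atom"

definition append_data :: "data \<Rightarrow> data \<Rightarrow> data" where
  "append_data a b = loop (\<lambda>l a. Pair (first l) a) (rev_data a) b"

text \<open>Emitting a singleton gives a map, emitting a singleton or nothing gives a filter, and
  testing the result against \<open>Atom\<close> gives a quantifier over the list.\<close>

definition flat_map :: "(data \<Rightarrow> data) \<Rightarrow> data \<Rightarrow> data" where
  "flat_map g d = loop (\<lambda>l a. append_data a (g l)) d Atom"

lemma elems_loop_Pair: "elems (loop (\<lambda>l a. Pair (first l) a) d a) = rev (elems d) @ elems a"
  by (induction d arbitrary: a) auto

lemma elems_rev_data [simp]: "elems (rev_data d) = rev (elems d)"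
  by (simp add: rev_data_def elems_loop_Pair)

lemma elems_append_data [simp]: "elems (append_data a b) = elems a @ elems b"
  by (simp add: append_data_def elems_loop_Pair)

lemma elems_flat_map: "elems (flat_map g d) = concat (map (\<lambda>l. elems (g l)) (suffixes d))"
proof -
  have "elems (loop (\<lambda>l a. append_data a (g l)) d a) =
      elems a @ concat (map (\<lambda>l. elems (g l)) (suffixes d))" for a
    by (induction d arbitrary: a) auto
  then show ?thesis by (simp add: flat_map_def)
qed

lemma elems_flat_map_first:
  "elems (flat_map (\<lambda>l. g (first l)) d) = concat (map (\<lambda>x. elems (g x)) (elems d))"
proof -
  have "map (\<lambda>l. elems (g (first l))) (suffixes d) = map (\<lambda>x. elems (g x)) (elems d)"
    by (induction d) auto
  then show ?thesis by (simp add: elems_flat_map)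
qed

lemma data_size_append_data: "data_size (append_data a b) \<le> data_size a + data_size b"
  unfolding data_size_eq[of "append_data a b"] data_size_eq[of a] data_size_eq[of b] by simp

lemma polytime_rev_data:
  assumes "polytime_fun F"
  shows "polytime_fun (\<lambda>Q x. rev_data (F Q x))"
  unfolding rev_data_def
proof (rule polytime_loop[where r = "[:1, 1:]"])
  show "data_size (Pair (first l) a) \<le> data_size a + poly [:1, 1:] (data_size x + data_size l)"
    for x l a
    using data_size_first[of l] by simp
qed (intro assms polytime_id polytime_const polytime_first polytime_second polytime_Pair)+

lemma polytime_append_data:
  assumes "polytime_fun F" and "polytime_fun G"
  shows "polytime_fun (\<lambda>Q x. append_data (F Q x) (G Q x))"
  unfolding append_data_def
proof (rule polytime_loop[where r = "[:1, 1:]"])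
  show "data_size (Pair (first l) a) \<le> data_size a + poly [:1, 1:] (data_size x + data_size l)"
    for x l a
    using data_size_first[of l] by simp
qed (intro assms polytime_id polytime_const polytime_first polytime_second polytime_Pair
      polytime_rev_data)+

text \<open>The block emitted for \<open>l\<close> depends on \<open>x\<close> and \<open>l\<close>
  but not on what was emitted before. So the additive growth condition holds with the polynomial of
  \<open>G\<close>, shifted by one for the node of the pair of \<open>x\<close> and
  \<open>l\<close>.\<close>

lemma polytime_flat_map:
  assumes G: "polytime_fun (\<lambda>Q e. G Q (first e) (second e))" and L: "polytime_fun L"
  shows "polytime_fun (\<lambda>Q x. flat_map (G Q x) (L Q x))"
proof -
  obtain c p where c: "computes c p (\<lambda>Q e. G Q (first e) (second e))"
    using G unfolding polytime_fun_def by blast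
  have size: "data_size (G Q x l) \<le> poly (pcompose p [:1, 1:]) (data_size x + data_size l)" for Q x l
    using computes_size[OF c order_refl, of Q "Pair x l"] by (simp add: poly_pcompose)
  show ?thesis
    unfolding flat_map_def
  proof (rule polytime_loop[where r = "pcompose p [:1, 1:]"])
    show "polytime_fun (\<lambda>Q e. append_data (second e) (G Q (first (first e)) (second (first e))))"
      by (intro polytime_append_data polytime_comp[OF G] polytime_first polytime_second polytime_id)
    show "data_size (append_data a (G Q x l)) \<le>
        data_size a + poly (pcompose p [:1, 1:]) (data_size x + data_size l)" for Q x l a
      using data_size_append_data[of a "G Q x l"] size[of Q x l] by linarith
  qed (intro L polytime_const)+
qed

lemmas polytime_intros =
  polytime_id polytime_const polytime_Pair polytime_first polytime_second polytime_if
  polytime_oracle polytime_eq polytime_not polytime_rev_data polytime_append_data polytime_flat_map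

section \<open>Simulating a program with a computed oracle\<close>

text \<open>One more than the largest variable that occurs; the cells from there on are free for a
  simulation.\<close>

fun expr_bound :: "expr \<Rightarrow> nat" where
  "expr_bound (Var x) = Suc x"
| "expr_bound (Const d) = 0"
| "expr_bound (Cons_of a b) = max (expr_bound a) (expr_bound b)"
| "expr_bound (First a) = expr_bound a"
| "expr_bound (Second a) = expr_bound a"
| "expr_bound (Equal a b) = max (expr_bound a) (expr_bound b)"

fun com_bound :: "com \<Rightarrow> nat" where
  "com_bound Skip = 0"
| "com_bound (Assign x e) = max (Suc x) (expr_bound e)"
| "com_bound (Query x e) = max (Suc x) (expr_bound e)"
| "com_bound (Seq c d) = max (com_bound c) (com_bound d)"
| "com_bound (If e c d) = max (expr_bound e) (max (com_bound c) (com_bound d))"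
| "com_bound (While e c) = max (expr_bound e) (com_bound c)"

lemma expr_agree:
  assumes "\<forall>v<n. s v = s' v" and "expr_bound e \<le> n"
  shows "eval_expr e s = eval_expr e s'" and "expr_cost e s = expr_cost e s'"
proof -
  have "eval_expr e s = eval_expr e s' \<and> expr_cost e s = expr_cost e s'"
    using assms by (induction e) auto
  then show "eval_expr e s = eval_expr e s'" and "expr_cost e s = expr_cost e s'" by auto
qed

lemma data_size_eval_expr: "data_size (eval_expr e s) \<le> expr_cost e s"
  by (cases e) auto

text \<open>
  Variable \<open>n\<close>, which the simulated program does not touch, holds a parameter that the
  subroutine \<open>q\<close> answering the queries receives together with the query.
\<close>

fun simulate :: "com \<Rightarrow> nat \<Rightarrow> com \<Rightarrow> com" where
  "simulate q n (Query x e) =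
     Seq (Assign (Suc n) (Cons_of e (Var n))) (Seq q (Assign x (Var (Suc n))))"
| "simulate q n (Seq c d) = Seq (simulate q n c) (simulate q n d)"
| "simulate q n (If e c d) = If e (simulate q n c) (simulate q n d)"
| "simulate q n (While e c) = While e (simulate q n c)"
| "simulate q n Skip = Skip"
| "simulate q n (Assign x e) = Assign x e"

text \<open>Evaluating a query is charged at least its size, so every query in a run of time at most
  \<open>T\<close> has size at most \<open>T\<close>, which bounds the cost of one call of the
  subroutine. Every simulated step takes time at least 1, so a factor \<open>W\<close> covers it.
  \<open>T\<close> stays fixed while the time \<open>t\<close> of the subprograms shrinks in the
  induction.\<close>

lemma triple_simulate:
  assumes comp: "computes c p (\<lambda>Q z. bool_data (A Q (first z) (second z)))"
    and "run (\<lambda>y. A Q y x) prog s t s'" and "com_bound prog \<le> n" and "t \<le> T"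
    and "\<forall>v<n. \<sigma> v = s v" and "\<sigma> n = x"
    and W: "W = 2 * data_size x + 8 + poly p (T + data_size x + 1)"
  shows "triple Q \<sigma> (simulate (c (Suc n)) n prog) (t * W)
    (\<lambda>\<sigma>'. (\<forall>v<n. \<sigma>' v = s' v) \<and> \<sigma>' n = x)"
  using assms(2-6)
proof (induction arbitrary: \<sigma> rule: run.induct)
  case (Skip s)
  then show ?case using W by (auto intro!: triple_Skip)
next
  case (Assign v e s)
  have "Suc (expr_cost e s) * 1 \<le> Suc (expr_cost e s) * W"
    by (rule mult_left_mono) (auto simp: W)
  then show ?case
    using expr_agree[of n \<sigma> s e] Assign by (auto intro!: triple_Assign)
next
  case (Query v e s)
  let ?q = "eval_expr e s"
  let ?t = "Suc (expr_cost e s)"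
  note agree = expr_agree[of n \<sigma> s e]
  have q: "data_size ?q \<le> T" "data_size ?q \<le> expr_cost e s"
    using data_size_eval_expr[of e s] Query.prems by auto
  have "triple Q (\<sigma>(Suc n := Pair ?q x)) (Seq (c (Suc n)) (Assign v (Var (Suc n))))
      (poly p (T + data_size x + 1) + 4) (\<lambda>\<sigma>'. (\<forall>u<n. \<sigma>' u = (s(v := bool_data (A Q ?q x))) u) \<and> \<sigma>' n = x)"
    by (rule computes_Seq[OF comp], (use q in simp), rule triple_Assign)
      (use Query.prems data_size_bool_data in auto)
  then have "triple Q \<sigma> (simulate (c (Suc n)) n (Query v e))
      ((2 * ?t + 2 * data_size x + 2) + (poly p (T + data_size x + 1) + 4))
      (\<lambda>\<sigma>'. (\<forall>u<n. \<sigma>' u = (s(v := bool_data (A Q ?q x))) u) \<and> \<sigma>' n = x)"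
    unfolding simulate.simps
    by (intro triple_Assign_Seq) (use q Query.prems agree in auto)
  then show ?case
  proof (rule triple_weaken)
    \<comment> \<open>\<open>W = K + 2\<close>: the 2, multiplied by \<open>?t\<close>, pays for
      evaluating the query and pairing it with \<open>x\<close>; one \<open>K\<close> pays for the
      remaining overhead and the call, and \<open>?t\<close> is at least 1.\<close>
    define K where "K = 2 * data_size x + 6 + poly p (T + data_size x + 1)"
    have "?t * W = 2 * ?t + ?t * K"
      by (simp add: W K_def algebra_simps)
    moreover have "K \<le> ?t * K"
      by simp
    ultimately show "(2 * ?t + 2 * data_size x + 2) + (poly p (T + data_size x + 1) + 4) \<le> ?t * W"
      using K_def by linarith
  qed auto
next
  case (Seq c1 s t1 s' c2 t2 s'')
  show ?case
    unfolding simulate.simps add_mult_distrib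
    by (rule triple_Seq[OF Seq.IH(1)]) (use Seq in auto)
next
  case (IfTrue e s c1 t s' c2)
  have le: "Suc (expr_cost e s) * 1 \<le> Suc (expr_cost e s) * W"
    by (rule mult_left_mono) (auto simp: W)
  have ag: "eval_expr e \<sigma> = eval_expr e s" "expr_cost e \<sigma> = expr_cost e s"
    using expr_agree[of n \<sigma> s e] IfTrue.prems by auto
  have "triple Q \<sigma> (simulate (c (Suc n)) n (If e c1 c2)) (Suc (expr_cost e \<sigma> + t * W))
      (\<lambda>\<sigma>'. (\<forall>v<n. \<sigma>' v = s' v) \<and> \<sigma>' n = x)"
    unfolding simulate.simps by (rule triple_If) (use IfTrue ag in auto)
  then show ?case
    by (rule triple_weaken) (use le ag in \<open>auto simp: algebra_simps\<close>)
next
  case (IfFalse e s c2 t s' c1)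
  have le: "Suc (expr_cost e s) * 1 \<le> Suc (expr_cost e s) * W"
    by (rule mult_left_mono) (auto simp: W)
  have ag: "eval_expr e \<sigma> = eval_expr e s" "expr_cost e \<sigma> = expr_cost e s"
    using expr_agree[of n \<sigma> s e] IfFalse.prems by auto
  have "triple Q \<sigma> (simulate (c (Suc n)) n (If e c1 c2)) (Suc (expr_cost e \<sigma> + t * W))
      (\<lambda>\<sigma>'. (\<forall>v<n. \<sigma>' v = s' v) \<and> \<sigma>' n = x)"
    unfolding simulate.simps by (rule triple_If) (use IfFalse ag in auto)
  then show ?case
    by (rule triple_weaken) (use le ag in \<open>auto simp: algebra_simps\<close>)
next
  case (WhileFalse e s d)
  have le: "Suc (expr_cost e s) * 1 \<le> Suc (expr_cost e s) * W"
    by (rule mult_left_mono) (auto simp: W)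
  have ag: "eval_expr e \<sigma> = eval_expr e s" "expr_cost e \<sigma> = expr_cost e s"
    using expr_agree[of n \<sigma> s e] WhileFalse.prems by auto
  show ?case
    unfolding simulate.simps by (rule triple_While_False) (use WhileFalse ag le in auto)
next
  case (WhileTrue e s d t1 s' t2 s'')
  have le: "Suc (expr_cost e s) * 1 \<le> Suc (expr_cost e s) * W"
    by (rule mult_left_mono) (auto simp: W)
  have ag: "eval_expr e \<sigma> = eval_expr e s" "expr_cost e \<sigma> = expr_cost e s"
    using expr_agree[of n \<sigma> s e] WhileTrue.prems by auto
  have body: "triple Q \<sigma> (simulate (c (Suc n)) n d) (t1 * W)
      (\<lambda>\<sigma>'. (\<forall>v<n. \<sigma>' v = s' v) \<and> \<sigma>' n = x)"
    by (rule WhileTrue.IH(1)) (use WhileTrue.prems in auto)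
  have rest: "triple Q \<sigma>' (While e (simulate (c (Suc n)) n d)) (t2 * W)
      (\<lambda>\<sigma>'. (\<forall>v<n. \<sigma>' v = s'' v) \<and> \<sigma>' n = x)"
    if "(\<forall>v<n. \<sigma>' v = s' v) \<and> \<sigma>' n = x" for \<sigma>'
    using WhileTrue.IH(2)[of \<sigma>'] WhileTrue.prems that by auto
  have "triple Q \<sigma> (While e (simulate (c (Suc n)) n d)) (Suc (expr_cost e \<sigma> + t1 * W + t2 * W))
      (\<lambda>\<sigma>'. (\<forall>v<n. \<sigma>' v = s'' v) \<and> \<sigma>' n = x)"
    by (rule triple_While_True[OF _ body rest]) (use WhileTrue.hyps ag in auto)
  then show ?case
    unfolding simulate.simps
    by (rule triple_weaken) (use le ag in \<open>auto simp: algebra_simps\<close>)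
qed

section \<open>Direct sums of matroids\<close>

lemma card_le_rank:
  assumes "matroid A \<I>" and "X \<in> \<I>" and "X \<subseteq> R"
  shows "card X \<le> rank \<I> R"
proof -
  have "finite \<I>"
    using assms(1) unfolding matroid_def by (meson finite_Pow_iff finite_subset)
  then show ?thesis
    unfolding rank_def using assms(2,3) by (intro Max_ge) auto
qed

lemma obtain_rank:
  assumes "matroid A \<I>"
  obtains X where "X \<in> \<I>" and "X \<subseteq> R" and "card X = rank \<I> R"
proof -
  have "finite \<I>" "{} \<in> \<I>"
    using assms(1) unfolding matroid_def by (meson finite_Pow_iff finite_subset)+
  then have "rank \<I> R \<in> card ` {X \<in> \<I>. X \<subseteq> R}"
    unfolding rank_def by (intro Max_in) auto
  then show ?thesis using that by auto
qed

lemma rank_le_card: "matroid A \<I> \<Longrightarrow> finite R \<Longrightarrow> rank \<I> R \<le> card R"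
  by (metis obtain_rank card_mono)

text \<open>An independent subset of \<open>R\<close> with as many elements as \<open>R\<close> is
  \<open>R\<close> itself. As ranks are natural numbers, a dependent set has deficiency at least 1,
  which is the charge for an infeasible copy.\<close>

lemma rank_less_card:
  assumes "matroid A \<I>" and "finite R" and "R \<notin> \<I>"
  shows "rank \<I> R < card R"
proof (rule ccontr)
  assume *: "\<not> rank \<I> R < card R"
  obtain X where "X \<in> \<I>" "X \<subseteq> R" "card X = rank \<I> R"
    using obtain_rank[OF assms(1)] .
  with * assms(2) have "X = R"
    by (metis card_subset_eq card_mono le_antisym not_less)
  with \<open>X \<in> \<I>\<close> assms(3) show False by simp
qed

definition slice :: "('i \<Rightarrow> 'a \<Rightarrow> 'b) \<Rightarrow> 'a set \<Rightarrow> 'i \<Rightarrow> 'b set \<Rightarrow> 'a set" where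
  "slice \<phi> A j R = {a \<in> A. \<phi> j a \<in> R}"

text \<open>The direct sum is phrased by preimages: each slice lives in the original ground set, so
  a question about it can be passed to the original oracle.\<close>

definition sum_indep ::
  "('i \<Rightarrow> 'a \<Rightarrow> 'b) \<Rightarrow> 'a set \<Rightarrow> 'i set \<Rightarrow> 'a set set \<Rightarrow> 'b set set" where
  "sum_indep \<phi> A J \<I> = {R. R \<subseteq> (\<Union>j\<in>J. \<phi> j ` A) \<and> (\<forall>j\<in>J. slice \<phi> A j R \<in> \<I>)}"

locale disjoint_copies =
  fixes \<phi> :: "'i \<Rightarrow> 'a \<Rightarrow> 'b" and A :: "'a set" and J :: "'i set"
  assumes finite_A: "finite A" and finite_J: "finite J"
    and copies_eq: "\<lbrakk>j \<in> J; j' \<in> J; a \<in> A; a' \<in> A; \<phi> j a = \<phi> j' a'\<rbrakk> \<Longrightarrow> j = j' \<and> a = a'"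
begin

lemma card_eq_sum_slice:
  assumes "R \<subseteq> (\<Union>j\<in>J. \<phi> j ` A)"
  shows "card R = (\<Sum>j\<in>J. card (slice \<phi> A j R))"
proof -
  have "R = (\<Union>j\<in>J. \<phi> j ` slice \<phi> A j R)"
  proof (intro equalityI subsetI)
    fix x assume "x \<in> R"
    then obtain j a where "j \<in> J" "a \<in> A" "x = \<phi> j a"
      using assms by blast
    with \<open>x \<in> R\<close> show "x \<in> (\<Union>j\<in>J. \<phi> j ` slice \<phi> A j R)"
      by (auto simp: slice_def)
  qed (auto simp: slice_def)
  moreover have "card (\<Union>j\<in>J. \<phi> j ` slice \<phi> A j R) = (\<Sum>j\<in>J. card (\<phi> j ` slice \<phi> A j R))"
    by (rule card_UN_disjoint)
      (use finite_J finite_A copies_eq in \<open>auto simp: slice_def\<close>)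
  moreover have "card (\<phi> j ` slice \<phi> A j R) = card (slice \<phi> A j R)" if "j \<in> J" for j
    by (rule card_image) (use copies_eq that in \<open>auto simp: inj_on_def slice_def\<close>)
  ultimately show ?thesis by simp
qed

lemma slice_insert:
  assumes "j \<in> J" and "j' \<in> J" and "a \<in> A"
  shows "slice \<phi> A j' (insert (\<phi> j a) R) =
    (if j' = j then insert a (slice \<phi> A j' R) else slice \<phi> A j' R)"
  using assms copies_eq by (auto simp: slice_def)

text \<open>For the exchange property, cardinalities add up over the slices, so a larger
  \<open>Y\<close> has some slice larger than that of \<open>X\<close>. An exchange there leaves all
  other slices of \<open>X\<close> unchanged.\<close>

lemma matroid_sum_indep:
  assumes "matroid A \<I>"
  shows "matroid (\<Union>j\<in>J. \<phi> j ` A) (sum_indep \<phi> A J \<I>)"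
proof -
  have empty: "{} \<in> \<I>" and down: "\<And>X Y. X \<in> \<I> \<Longrightarrow> Y \<subseteq> X \<Longrightarrow> Y \<in> \<I>"
    and exch: "\<And>X Y. \<lbrakk>X \<in> \<I>; Y \<in> \<I>; card X < card Y\<rbrakk> \<Longrightarrow> \<exists>y\<in>Y - X. insert y X \<in> \<I>"
    using assms unfolding matroid_def by auto
  have "finite (\<Union>j\<in>J. \<phi> j ` A)"
    using finite_A finite_J by auto
  moreover have "sum_indep \<phi> A J \<I> \<subseteq> Pow (\<Union>j\<in>J. \<phi> j ` A)"
    by (auto simp: sum_indep_def)
  moreover have "{} \<in> sum_indep \<phi> A J \<I>"
    using empty by (auto simp: sum_indep_def slice_def)
  moreover have "Y \<in> sum_indep \<phi> A J \<I>" if X: "X \<in> sum_indep \<phi> A J \<I>" and Y: "Y \<subseteq> X" for X Y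
  proof -
    have "slice \<phi> A j Y \<in> \<I>" if "j \<in> J" for j
      by (rule down[of "slice \<phi> A j X"]) (use X Y that in \<open>auto simp: slice_def sum_indep_def\<close>)
    then show ?thesis
      using X Y unfolding sum_indep_def by auto
  qed
  moreover have "\<exists>y\<in>Y - X. insert y X \<in> sum_indep \<phi> A J \<I>"
    if X: "X \<in> sum_indep \<phi> A J \<I>" and Y: "Y \<in> sum_indep \<phi> A J \<I>" and less: "card X < card Y" for X Y
  proof -
    have "(\<Sum>j\<in>J. card (slice \<phi> A j X)) < (\<Sum>j\<in>J. card (slice \<phi> A j Y))"
      using X Y less card_eq_sum_slice[of X] card_eq_sum_slice[of Y] unfolding sum_indep_def by simp
    then obtain j where j: "j \<in> J" "card (slice \<phi> A j X) < card (slice \<phi> A j Y)"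
      using sum_mono[of J "\<lambda>j. card (slice \<phi> A j Y)" "\<lambda>j. card (slice \<phi> A j X)"] not_less by metis
    moreover have "slice \<phi> A j X \<in> \<I>" "slice \<phi> A j Y \<in> \<I>"
      using X Y j(1) unfolding sum_indep_def by auto
    ultimately obtain y where y: "y \<in> slice \<phi> A j Y - slice \<phi> A j X" "insert y (slice \<phi> A j X) \<in> \<I>"
      using exch by blast
    have yA: "y \<in> A" using y(1) by (auto simp: slice_def)
    have "slice \<phi> A j' (insert (\<phi> j y) X) \<in> \<I>" if "j' \<in> J" for j'
      using slice_insert[OF j(1) that yA] y(2) X that unfolding sum_indep_def by auto
    then have "insert (\<phi> j y) X \<in> sum_indep \<phi> A J \<I>"
      using X j(1) yA unfolding sum_indep_def by auto
    moreover have "\<phi> j y \<in> Y - X"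
      using y(1) by (auto simp: slice_def)
    ultimately show ?thesis by blast
  qed
  ultimately show ?thesis
    unfolding matroid_def by auto
qed

text \<open>A maximum independent subset of \<open>R\<close> has independent slices. Since
  cardinalities add up exactly, this bounds the sum of the deficiencies of the slices by the
  deficiency of \<open>R\<close>.\<close>

lemma rank_sum_indep_le:
  assumes "matroid A \<I>"
  shows "rank (sum_indep \<phi> A J \<I>) R \<le> (\<Sum>j\<in>J. rank \<I> (slice \<phi> A j R))"
proof -
  obtain X where X: "X \<in> sum_indep \<phi> A J \<I>" "X \<subseteq> R" "card X = rank (sum_indep \<phi> A J \<I>) R"
    using obtain_rank[OF matroid_sum_indep[OF assms]] .
  have "card X = (\<Sum>j\<in>J. card (slice \<phi> A j X))"
    using X(1) by (intro card_eq_sum_slice) (auto simp: sum_indep_def)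
  also have "\<dots> \<le> (\<Sum>j\<in>J. rank \<I> (slice \<phi> A j R))"
    by (intro sum_mono card_le_rank[OF assms])
      (use X in \<open>auto simp: sum_indep_def slice_def\<close>)
  finally show ?thesis using X(3) by simp
qed

end

section \<open>Spanning trees of connected graphs\<close>

lemma edge_rel_sym:
  "(x, y) \<in> {(x, y). {x, y} \<in> E}\<^sup>* \<Longrightarrow> (y, x) \<in> {(x, y). {x, y} \<in> E}\<^sup>*"
proof -
  have "sym {(x, y). {x, y} \<in> E}"
    by (auto simp: sym_def insert_commute)
  then show "(x, y) \<in> {(x, y). {x, y} \<in> E}\<^sup>* \<Longrightarrow> (y, x) \<in> {(x, y). {x, y} \<in> E}\<^sup>*"
    by (meson sym_rtrancl symD)
qed

text \<open>The rest of the cycle is a detour between \<open>p ! 1\<close> and \<open>p ! 0\<close>,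
  so each use of the removed edge can be replaced.\<close>

lemma connected_graph_remove_cycle_edge:
  assumes conn: "connected_graph V T" and cyc: "is_cycle T p"
  shows "connected_graph V (T - {{p ! 0, p ! 1}})"
proof -
  let ?n = "length p"
  let ?T = "T - {{p ! 0, p ! 1}}"
  let ?R = "{(x, y). {x, y} \<in> ?T}"
  have n: "3 \<le> ?n" and dist: "distinct p"
    and edge: "\<And>i. i < ?n \<Longrightarrow> {p ! i, p ! (Suc i mod ?n)} \<in> T"
    using cyc unfolding is_cycle_def by auto
  have eq: "p ! i = p ! j \<longleftrightarrow> i = j" if "i < ?n" "j < ?n" for i j
    using nth_eq_iff_index_eq[OF dist that] .
  have path: "(p ! 1, p ! Suc i) \<in> ?R\<^sup>*" if "Suc i < ?n" for i
    using that
  proof (induction i)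
    case (Suc i)
    have "{p ! Suc i, p ! Suc (Suc i)} \<in> T"
      using edge[of "Suc i"] Suc.prems by simp
    moreover have "p ! Suc i \<noteq> p ! 0" "p ! Suc (Suc i) \<noteq> p ! 0"
      using Suc.prems eq[of "Suc i" 0] eq[of "Suc (Suc i)" 0] by linarith+
    then have "{p ! Suc i, p ! Suc (Suc i)} \<noteq> {p ! 0, p ! 1}"
      by (auto simp: doubleton_eq_iff)
    ultimately show ?case
      using Suc by (auto intro: rtrancl_into_rtrancl)
  qed simp
  have "{p ! (?n - 1), p ! 0} \<in> T"
  proof -
    have "Suc (?n - 1) = ?n"
      using n by simp
    then show ?thesis
      using edge[of "?n - 1"] n by simp
  qed
  moreover have "p ! (?n - 1) \<noteq> p ! 0" "p ! (?n - 1) \<noteq> p ! 1"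
    using n eq[of "?n - 1" 0] eq[of "?n - 1" 1] by linarith+
  then have "{p ! (?n - 1), p ! 0} \<noteq> {p ! 0, p ! 1}"
    by (auto simp: doubleton_eq_iff)
  ultimately have *: "(p ! (?n - 1), p ! 0) \<in> ?R"
    by simp
  have "(p ! 1, p ! 0) \<in> ?R\<^sup>*"
  proof -
    have "Suc (?n - 2) = ?n - 1"
      using n by simp
    then have "(p ! 1, p ! (?n - 1)) \<in> ?R\<^sup>*"
      using path[of "?n - 2"] n by simp
    then show ?thesis
      using * by (rule rtrancl_into_rtrancl)
  qed
  moreover from this have "(p ! 0, p ! 1) \<in> ?R\<^sup>*"
    by (rule edge_rel_sym)
  ultimately have "{(x, y). {x, y} \<in> T} \<subseteq> ?R\<^sup>*"
    by (auto simp: doubleton_eq_iff)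
  then have "{(x, y). {x, y} \<in> T}\<^sup>* \<subseteq> ?R\<^sup>*"
    using rtrancl_subset_rtrancl by blast
  then show ?thesis
    using conn unfolding connected_graph_def by blast
qed

lemma connected_graph_spanning_tree:
  assumes "finite T" and "connected_graph V T"
  obtains T' where "spanning_tree V T T'"
proof -
  \<comment> \<open>A connected subgraph with the fewest edges is acyclic, because an edge on a
    cycle could be dropped.\<close>
  define k where "k = (LEAST k. \<exists>T'\<subseteq>T. connected_graph V T' \<and> card T' = k)"
  have "\<exists>T'\<subseteq>T. connected_graph V T' \<and> card T' = k"
    unfolding k_def by (rule LeastI_ex) (use assms(2) in auto)
  then obtain T' where T': "T' \<subseteq> T" "connected_graph V T'" "card T' = k"
    by blast
  have "acyclic_graph T'"
    unfolding acyclic_graph_def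
  proof
    assume "\<exists>p. is_cycle T' p"
    then obtain p where p: "is_cycle T' p" by blast
    let ?T = "T' - {{p ! 0, p ! 1}}"
    have "{p ! 0, p ! (Suc 0 mod length p)} \<in> T'" "3 \<le> length p"
      using p unfolding is_cycle_def by (metis less_le_trans zero_less_numeral)+
    then have "{p ! 0, p ! 1} \<in> T'" by simp
    then have "card ?T < k"
      using T'(1,3) assms(1) by (metis card_Diff1_less finite_subset)
    moreover have "connected_graph V ?T"
      using connected_graph_remove_cycle_edge[OF T'(2) p] .
    ultimately show False
      using not_less_Least[of "card ?T"] T'(1) unfolding k_def by blast
  qed
  then show ?thesis
    using T' that unfolding spanning_tree_def by blast
qed

section \<open>Gluing copies of an instance\<close>

text \<open>
  All copies share the vertex \<open>r\<close>, renamed to \<open>Atom\<close>. Joining the copies by new edges instead would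
  require costs for them, and \<open>D\<close> may be empty.
\<close>

definition copy :: "data \<Rightarrow> data \<Rightarrow> data \<Rightarrow> data" where
  "copy r j v = (if v = r then Atom else Pair j v)"

definition uncopy :: "data \<Rightarrow> data \<Rightarrow> data" where
  "uncopy r w = (if w = Atom then r else second w)"

lemma uncopy_copy [simp]: "uncopy r (copy r j v) = v"
  by (simp add: copy_def uncopy_def)

lemma copy_eq_iff: "copy r j u = copy r j' v \<longleftrightarrow> u = v \<and> (u = r \<or> j = j')"
  by (auto simp: copy_def)

lemma inj_copy: "inj (copy r j)"
  by (auto simp: inj_def copy_eq_iff)

lemma uncopy_image_copy [simp]: "uncopy r ` copy r j ` e = e"
  by (simp add: image_image)

text \<open>Forgetting the tags recovers the edge, and an edge with two endpoints has one other than
  the root, on which the tag can be read.\<close>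

lemma copy_image_eq:
  assumes "card e = 2" and "copy r j ` e = copy r j' ` e'"
  shows "j = j' \<and> e = e'"
proof -
  have e: "e = e'"
    using uncopy_image_copy[of r j e] uncopy_image_copy[of r j' e'] assms(2) by simp
  have "\<not> e \<subseteq> {r}"
    using assms(1) card_mono[of "{r}" e] by auto
  then obtain v where v: "v \<in> e" "v \<noteq> r"
    by blast
  then have "copy r j v \<in> copy r j' ` e'"
    using assms(2) by blast
  then have "j = j'"
    using v by (auto simp: copy_eq_iff)
  with e show ?thesis by simp
qed

text \<open>\<open>uncopy\<close> undoes every copy whatever its tag, so each new edge has the cost
  of its original, and costs stay in \<open>D\<close>.\<close>

definition glue :: "data \<Rightarrow> data set \<Rightarrow> data gmdst \<Rightarrow> data gmdst" where
  "glue r J M =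
     \<lparr>verts = (\<Union>j\<in>J. copy r j ` verts M),
      edges = (\<Union>j\<in>J. image (copy r j) ` edges M),
      cost = (\<lambda>e. cost M (uncopy r ` e)),
      num = num M,
      node_set = (\<lambda>i. \<Union>j\<in>J. copy r j ` node_set M i),
      indep = (\<lambda>i. sum_indep (\<lambda>j. image (copy r j)) (delta M i) J (indep M i))\<rparr>"

locale gluing =
  fixes M :: "data gmdst" and r :: data and J :: "data set"
  assumes inst: "gmdst_instance M" and root: "r \<in> verts M"
    and finite_J: "finite J" and J_nonempty: "J \<noteq> {}"
begin

abbreviation "G \<equiv> glue r J M"
abbreviation "\<phi> j \<equiv> image (copy r j)"
abbreviation "part j R \<equiv> slice \<phi> (edges M) j R"

lemma edge_card: "e \<in> edges M \<Longrightarrow> card e = 2"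
  and edge_subset: "e \<in> edges M \<Longrightarrow> e \<subseteq> verts M"
  and finite_verts: "finite (verts M)"
  using inst unfolding gmdst_instance_def simple_graph_def by auto

lemma finite_edges: "finite (edges M)"
  by (rule finite_subset[of _ "Pow (verts M)"]) (use edge_subset finite_verts in auto)

lemma delta_subset: "delta M i \<subseteq> edges M"
  by (auto simp: delta_def cut_def)

lemma matroid_indep: "i < num M \<Longrightarrow> matroid (delta M i) (indep M i)"
  using inst unfolding gmdst_instance_def by blast

lemma disjoint_copies_subset: "A \<subseteq> edges M \<Longrightarrow> disjoint_copies \<phi> A J"
proof
  assume A: "A \<subseteq> edges M"
  then show "finite A"
    using finite_edges finite_subset by blast
  show "finite J"
    by (rule finite_J)
  show "j = j' \<and> e = e'" if "e \<in> A" "\<phi> j e = \<phi> j' e'" for j j' e e'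
    using copy_image_eq[OF _ that(2)] edge_card that(1) A by auto
qed

lemmas copies_edges = disjoint_copies_subset[OF order_refl]
lemmas copies_delta = disjoint_copies_subset[OF delta_subset]

lemma edges_glue: "edges G = (\<Union>j\<in>J. \<phi> j ` edges M)"
  by (simp add: glue_def)

lemma card_edges_glue: "card (edges G) = card J * card (edges M)"
proof -
  interpret disjoint_copies \<phi> "edges M" J
    by (rule copies_edges)
  have "part j (edges G) = edges M" if "j \<in> J" for j
    using that by (auto simp: slice_def edges_glue)
  then show ?thesis
    using card_eq_sum_slice[of "edges G"] by (simp add: edges_glue)
qed

lemma copy_image_mem_iff:
  assumes "j \<in> J" and "A \<subseteq> edges M"
  shows "\<phi> j e \<in> (\<Union>j\<in>J. \<phi> j ` A) \<longleftrightarrow> e \<in> A"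
proof
  assume "\<phi> j e \<in> (\<Union>j\<in>J. \<phi> j ` A)"
  then obtain j' e' where e': "e' \<in> A" "\<phi> j' e' = \<phi> j e"
    by auto
  then have "card e' = 2"
    using assms(2) edge_card by blast
  from copy_image_eq[OF this e'(2)] e'(1) show "e \<in> A"
    by simp
qed (use assms(1) in auto)

lemma edge_glue_iff: "j \<in> J \<Longrightarrow> \<phi> j e \<in> edges G \<longleftrightarrow> e \<in> edges M"
  unfolding edges_glue by (rule copy_image_mem_iff) auto

lemma copy_in_node_set_iff: "j \<in> J \<Longrightarrow> copy r j v \<in> node_set G i \<longleftrightarrow> v \<in> node_set M i"
  by (auto simp: glue_def copy_eq_iff)

text \<open>The shared root belongs to the glued node set exactly when it belongs to the original
  one, so no copy sees a changed node set; the injective renaming then preserves the number of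
  endpoints inside.\<close>

lemma delta_glue_iff:
  assumes "j \<in> J"
  shows "\<phi> j e \<in> delta G i \<longleftrightarrow> e \<in> delta M i"
proof -
  have "\<phi> j e \<inter> node_set G i = \<phi> j (e \<inter> node_set M i)"
    using copy_in_node_set_iff[OF assms] by auto
  then have "card (\<phi> j e \<inter> node_set G i) = card (e \<inter> node_set M i)"
    by (metis card_image inj_copy inj_on_subset subset_UNIV)
  then show ?thesis
    using edge_glue_iff[OF assms] by (simp add: delta_def cut_def)
qed

lemma delta_glue: "delta G i = (\<Union>j\<in>J. \<phi> j ` delta M i)"
proof (intro equalityI subsetI)
  fix x assume x: "x \<in> delta G i"
  then obtain j e where "j \<in> J" "e \<in> edges M" "x = \<phi> j e"
    by (auto simp: delta_def cut_def edges_glue)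
  with x show "x \<in> (\<Union>j\<in>J. \<phi> j ` delta M i)"
    using delta_glue_iff[of j e i] by auto
qed (use delta_glue_iff in auto)

lemma slice_delta: "j \<in> J \<Longrightarrow> slice \<phi> (delta M i) j (R \<inter> delta G i) = part j R \<inter> delta M i"
  using delta_subset[of i] by (auto simp: slice_def delta_glue_iff)

lemma indep_glue: "indep G i = sum_indep \<phi> (delta M i) J (indep M i)"
  by (simp add: glue_def)

lemma num_glue: "num G = num M"
  by (simp add: glue_def)

lemma verts_glue: "verts G = (\<Union>j\<in>J. copy r j ` verts M)"
  by (simp add: glue_def)

lemma glue_instance: "gmdst_instance G"
  unfolding gmdst_instance_def num_glue
proof (intro conjI allI impI)
  have "card (\<phi> j e) = 2" if "e \<in> edges M" for j e
    using edge_card[OF that] by (metis card_image inj_copy inj_on_subset subset_UNIV)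
  moreover have "\<phi> j e \<subseteq> verts G" if "j \<in> J" "e \<in> edges M" for j e
    using edge_subset[OF that(2)] that(1) by (auto simp: verts_glue)
  moreover have "finite (verts G)" "verts G \<noteq> {}"
    using finite_J J_nonempty finite_verts root by (auto simp: verts_glue)
  ultimately show "simple_graph (verts G) (edges G)"
    unfolding simple_graph_def edges_glue by auto
  show "node_set G i \<subseteq> verts G" if "i < num M" for i
  proof -
    have "node_set M i \<subseteq> verts M"
      using that inst unfolding gmdst_instance_def by blast
    then show ?thesis
      by (auto simp: glue_def)
  qed
  show "matroid (delta G i) (indep G i)" if "i < num M" for i
    unfolding delta_glue indep_glue
    by (rule disjoint_copies.matroid_sum_indep[OF copies_delta matroid_indep[OF that]])
  show "node_set G i \<inter> node_set G j = {}" if "i < num M" "j < num M" "i \<noteq> j" for i j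
  proof -
    have "node_set M i \<inter> node_set M j = {}"
      using that inst unfolding gmdst_instance_def by blast
    then show ?thesis
      by (auto simp: glue_def copy_eq_iff)
  qed
qed

text \<open>
  Instead of showing that the union of the copies of a feasible tree is acyclic, pass to a spanning
  tree inside it; independence is inherited by subsets.
\<close>

lemma feasible_glue:
  assumes "feasible_solution M T"
  shows "feasible_instance G"
proof -
  have T: "T \<subseteq> edges M" "connected_graph (verts M) T"
    and ind: "\<And>i. i < num M \<Longrightarrow> T \<inter> delta M i \<in> indep M i"
    using assms unfolding feasible_solution_def spanning_tree_def by auto
  define U where "U = (\<Union>j\<in>J. \<phi> j ` T)"
  let ?R = "{(x, y). {x, y} \<in> U}"
  have U: "U \<subseteq> edges G"
    using T(1) by (auto simp: U_def edges_glue)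
  have "finite U"
    using finite_J finite_subset[OF T(1) finite_edges] by (auto simp: U_def)
  have to_root: "(copy r j v, Atom) \<in> ?R\<^sup>*" if "j \<in> J" "v \<in> verts M" for j v
  proof -
    have "(v, r) \<in> {(x, y). {x, y} \<in> T}\<^sup>*"
      using T(2) that root unfolding connected_graph_def by blast
    moreover have "(copy r j v, copy r j w) \<in> ?R\<^sup>*" if "(v, w) \<in> {(x, y). {x, y} \<in> T}\<^sup>*" for w
      using that
    proof (induction rule: rtrancl_induct)
      case (step y z)
      then have "{copy r j y, copy r j z} \<in> U"
        using \<open>j \<in> J\<close> unfolding U_def by (intro UN_I[of j] image_eqI[of _ _ "{y, z}"]) auto
      with step.IH show ?case
        by (auto intro: rtrancl_into_rtrancl)
    qed simp
    ultimately have "(copy r j v, copy r j r) \<in> ?R\<^sup>*"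
      by blast
    then show ?thesis by (simp add: copy_def)
  qed
  have "connected_graph (verts G) U"
    unfolding connected_graph_def
  proof (intro ballI)
    fix u v assume "u \<in> verts G" "v \<in> verts G"
    then have "(u, Atom) \<in> ?R\<^sup>*" "(v, Atom) \<in> ?R\<^sup>*"
      using to_root by (auto simp: verts_glue)
    then show "(u, v) \<in> ?R\<^sup>*"
      by (auto dest: edge_rel_sym[of v] intro: rtrancl_trans[of u Atom])
  qed
  then obtain T' where T': "spanning_tree (verts G) U T'"
    using connected_graph_spanning_tree[OF \<open>finite U\<close>] by blast
  then have sub: "T' \<subseteq> U"
    by (simp add: spanning_tree_def)
  have "feasible_solution G T'"
    unfolding feasible_solution_def num_glue
  proof (intro conjI allI impI)
    show "spanning_tree (verts G) (edges G) T'"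
      using T' U unfolding spanning_tree_def by auto
    fix i assume i: "i < num M"
    have "slice \<phi> (delta M i) j (T' \<inter> delta G i) \<in> indep M i" if j: "j \<in> J" for j
    proof -
      have "e \<in> T" if "\<phi> j e \<in> U" for e
        using that copy_image_mem_iff[OF j T(1)] unfolding U_def by simp
      then have "slice \<phi> (delta M i) j (T' \<inter> delta G i) \<subseteq> T \<inter> delta M i"
        unfolding slice_delta[OF j] using sub by (auto simp: slice_def)
      then show ?thesis
        using ind[OF i] matroid_indep[OF i] unfolding matroid_def by blast
    qed
    then show "T' \<inter> delta G i \<in> indep G i"
      unfolding indep_glue sum_indep_def delta_glue by blast
  qed
  with glue_instance show ?thesis
    unfolding feasible_instance_def by blast
qed

text \<open>Paths are projected onto the copy and cycles are lifted from it. Other copies are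
  attached only at the root, so an excursion of a path into them returns there.\<close>

lemma spanning_tree_part:
  assumes "spanning_tree (verts G) (edges G) T" and j: "j \<in> J"
  shows "spanning_tree (verts M) (edges M) (part j T)"
proof -
  have T: "T \<subseteq> edges G" "connected_graph (verts G) T" "acyclic_graph T"
    using assms(1) unfolding spanning_tree_def by auto
  let ?P = "{(x, y). {x, y} \<in> part j T}"
  \<comment> \<open>A retraction onto copy \<open>j\<close> that collapses all other copies to the
    root: an edge of another copy becomes stationary.\<close>
  define \<pi> where "\<pi> w = (if w \<in> range (copy r j) then uncopy r w else r)" for w
  have \<pi>_copy: "\<pi> (copy r j' v) = (if j' = j then v else r)" for j' v
    by (auto simp: \<pi>_def copy_def uncopy_def)
  have step: "(\<pi> x, \<pi> y) \<in> ?P\<^sup>*" if xy: "{x, y} \<in> T" for x y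
  proof -
    obtain j' e where e: "j' \<in> J" "e \<in> edges M" "{x, y} = \<phi> j' e"
      using xy T(1) by (auto simp: edges_glue)
    then obtain u v where uv: "x = copy r j' u" "y = copy r j' v"
      by (metis imageE insertI1 insert_commute)
    show ?thesis
    proof (cases "j' = j")
      case True
      have "\<phi> j e = \<phi> j {u, v}"
        using e(3) uv True by simp
      then have "e = {u, v}"
        using inj_copy by (metis inj_image_eq_iff)
      then have "(u, v) \<in> ?P"
        using e xy True by (auto simp: slice_def)
      then show ?thesis
        using uv True \<pi>_copy by auto
    qed (use uv \<pi>_copy in auto)
  qed
  have path: "(\<pi> x, \<pi> y) \<in> ?P\<^sup>*" if "(x, y) \<in> {(x, y). {x, y} \<in> T}\<^sup>*" for x y
    using that
  proof (induction rule: rtrancl_induct)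
    case (step y z)
    then show ?case
      using \<open>\<And>x y. {x, y} \<in> T \<Longrightarrow> (\<pi> x, \<pi> y) \<in> ?P\<^sup>*\<close>[of y z] by (auto intro: rtrancl_trans)
  qed simp
  have "connected_graph (verts M) (part j T)"
    unfolding connected_graph_def
  proof (intro ballI)
    fix u v assume "u \<in> verts M" "v \<in> verts M"
    then have "copy r j u \<in> verts G" "copy r j v \<in> verts G"
      using j by (auto simp: verts_glue)
    then have "(\<pi> (copy r j u), \<pi> (copy r j v)) \<in> ?P\<^sup>*"
      using T(2) path unfolding connected_graph_def by blast
    then show "(u, v) \<in> ?P\<^sup>*"
      by (simp add: \<pi>_copy)
  qed
  moreover have "acyclic_graph (part j T)"
    unfolding acyclic_graph_def
  proof
    assume "\<exists>p. is_cycle (part j T) p"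
    then obtain p where p: "is_cycle (part j T) p" by blast
    have "is_cycle T (map (copy r j) p)"
      unfolding is_cycle_def
    proof (intro conjI allI impI)
      show "3 \<le> length (map (copy r j) p)" "distinct (map (copy r j) p)"
        using p inj_copy by (auto simp: is_cycle_def distinct_map intro: inj_on_subset)
      fix i assume i: "i < length (map (copy r j) p)"
      then have "{p ! i, p ! (Suc i mod length p)} \<in> part j T"
        using p by (auto simp: is_cycle_def)
      moreover have "Suc i mod length p < length p"
        using i by (intro mod_less_divisor) auto
      ultimately show "{map (copy r j) p ! i, map (copy r j) p ! (Suc i mod length (map (copy r j) p))} \<in> T"
        using i by (auto simp: slice_def)
    qed
    with T(3) show False
      unfolding acyclic_graph_def by blast
  qed
  ultimately show ?thesis
    unfolding spanning_tree_def by (auto simp: slice_def)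
qed

text \<open>Double counting of the deficiencies over matroids and copies: an infeasible copy
  contributes at least 1 in total, while each matroid contributes at most the value of
  \<open>f\<close>. The edgeless case is separate because the growth condition on \<open>f\<close>
  says nothing about \<open>f 0\<close>.\<close>

lemma some_part_feasible:
  assumes T: "approx_solution f G T"
    and few: "edges M = {} \<or> real (num M) * f (card J * card (edges M)) < real (card J)"
  shows "\<exists>j\<in>J. feasible_solution M (part j T)"
proof (rule ccontr)
  assume none: "\<not> ?thesis"
  have st: "spanning_tree (verts G) (edges G) T"
    using T unfolding approx_solution_def by blast
  define d where "d i j = real (card (part j T \<inter> delta M i)) - real (rank (indep M i) (part j T \<inter> delta M i))"
    for i j
  have fin: "finite (part j T \<inter> delta M i)" for i j
    using finite_edges by (simp add: slice_def)
  have d_nonneg: "0 \<le> d i j" if "i < num M" for i j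
    using rank_le_card[OF matroid_indep[OF that] fin] by (simp add: d_def)
  have bad: "\<exists>i<num M. part j T \<inter> delta M i \<notin> indep M i" if "j \<in> J" for j
    using none that spanning_tree_part[OF st that] unfolding feasible_solution_def by blast
  have "1 \<le> (\<Sum>i<num M. d i j)" if j: "j \<in> J" for j
  proof -
    obtain i where i: "i < num M" "part j T \<inter> delta M i \<notin> indep M i"
      using bad[OF j] by blast
    have "1 \<le> d i j"
      using rank_less_card[OF matroid_indep[OF i(1)] fin i(2)] by (simp add: d_def)
    also have "\<dots> \<le> (\<Sum>i<num M. d i j)"
      by (rule member_le_sum) (use i d_nonneg in auto)
    finally show ?thesis .
  qed
  then have "real (card J) \<le> (\<Sum>j\<in>J. \<Sum>i<num M. d i j)"
    using sum_mono[of J "\<lambda>_. 1 :: real" "\<lambda>j. \<Sum>i<num M. d i j"] by simp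
  also have "\<dots> = (\<Sum>i<num M. \<Sum>j\<in>J. d i j)"
    by (rule sum.swap)
  also have "\<dots> \<le> (\<Sum>i<num M. f (card J * card (edges M)))"
  proof (rule sum_mono)
    fix i assume "i \<in> {..<num M}"
    then have i: "i < num M" by simp
    interpret disjoint_copies \<phi> "delta M i" J
      by (rule copies_delta)
    let ?R = "T \<inter> delta G i"
    have "card ?R = (\<Sum>j\<in>J. card (part j T \<inter> delta M i))"
    proof -
      have "?R \<subseteq> (\<Union>j\<in>J. \<phi> j ` delta M i)"
        using delta_glue by blast
      from card_eq_sum_slice[OF this] show ?thesis
        by (simp add: slice_delta)
    qed
    moreover have "rank (indep G i) ?R \<le> (\<Sum>j\<in>J. rank (indep M i) (part j T \<inter> delta M i))"
      using rank_sum_indep_le[OF matroid_indep[OF i], of ?R] by (simp add: slice_delta indep_glue)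
    ultimately have "(\<Sum>j\<in>J. d i j) \<le> real (card ?R) - real (rank (indep G i) ?R)"
      by (simp add: d_def sum_subtractf flip: of_nat_sum)
    also have "\<dots> \<le> f (card J * card (edges M))"
      using T i unfolding approx_solution_def additively_independent_def card_edges_glue num_glue
      by blast
    finally show "(\<Sum>j\<in>J. d i j) \<le> f (card J * card (edges M))" .
  qed
  finally have "real (card J) \<le> real (num M) * f (card J * card (edges M))"
    by simp
  \<comment> \<open>Only the edgeless alternative of \<open>few\<close> remains; there all parts are
    empty, hence independent.\<close>
  then have "edges M = {}"
    using few by linarith
  then have "part j T \<inter> delta M i = {}" for i j
    by (simp add: slice_def)
  moreover have "{} \<in> indep M i" if "i < num M" for i
    using matroid_indep[OF that] by (simp add: matroid_def)
  ultimately show False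
    using bad J_nonempty by (metis ex_in_conv)
qed

end

section \<open>Oracle reductions\<close>

text \<open>Writing a value costs at least its size. This bounds the output of the simulated
  algorithm, which is an input of the postprocessing.\<close>

lemma run_data_size: "run Q c s t s' \<Longrightarrow> data_size (s' v) \<le> data_size (s v) + t"
proof (induction rule: run.induct)
  case (Assign x e s)
  then show ?case using data_size_eval_expr[of e s] by simp
next
  case (Query x e s)
  \<comment> \<open>An answer can have size 3 whatever the query was; the old value, the expression
    and the step itself account for 1 each.\<close>
  have "1 \<le> expr_cost e s"
    using data_size_eval_expr[of e s] data_size_pos[of "eval_expr e s"] by linarith
  moreover have "1 \<le> data_size (s v)"
    using data_size_pos[of "s v"] by linarith
  ultimately show ?case
    using data_size_bool_data[of "Q (eval_expr e s)"] by (cases "v = x") auto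
qed auto

text \<open>A reduction in three stages: translate the input by \<open>P\<close>, run the algorithm
  with its queries answered by \<open>A\<close>, translate the output by \<open>S\<close>. The
  original input \<open>x\<close> must survive the run, since both \<open>A\<close> and
  \<open>S\<close> depend on it.\<close>

lemma polytime_reduction:
  assumes alg: "polytime_on_feasible D enc good"
    and pre: "polytime_fun (\<lambda>Q. P)"
    and query: "polytime_pred (\<lambda>Q z. A Q (first z) (second z))"
    and post: "polytime_fun (\<lambda>Q z. S Q (first z) (second z))"
    and red: "\<And>M x Q. \<lbrakk>feasible_instance M; instance_code D enc x M; independence_oracle M Q\<rbrakk> \<Longrightarrow>
      \<exists>M'. feasible_instance M' \<and> instance_code D enc (P x) M' \<and>
        independence_oracle M' (\<lambda>q. A Q q x) \<and>
        (\<forall>y T. edge_set_code y T \<and> good M' T \<longrightarrow>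
          (\<exists>T'. edge_set_code (S Q y x) T' \<and> good' M T'))"
  shows "polytime_on_feasible D enc good'"
proof -
  obtain c p where c: "\<And>M x Q. \<lbrakk>feasible_instance M; instance_code D enc x M; independence_oracle M Q\<rbrakk> \<Longrightarrow>
      \<exists>t s T. run Q c (initial_store x) t s \<and> t \<le> poly p (data_size x) \<and>
        edge_set_code (s 0) T \<and> good M T"
    using alg unfolding polytime_on_feasible_def by blast
  obtain cp pp where cp: "computes cp pp (\<lambda>Q. P)"
    using pre unfolding polytime_fun_def by blast
  obtain co po where co: "computes co po (\<lambda>Q z. bool_data (A Q (first z) (second z)))"
    using query unfolding polytime_pred_def polytime_fun_def by (elim exE)
  obtain cs ps where cs: "computes cs ps (\<lambda>Q z. S Q (first z) (second z))"
    using post unfolding polytime_fun_def by (elim exE)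
  \<comment> \<open>Cell \<open>n\<close> keeps the original input and the cells above it are
    scratch space. The \<open>Suc\<close> makes the output cell 0 lie below \<open>n\<close> even if
    \<open>c\<close> mentions no variable.\<close>
  define n where "n = Suc (com_bound c)"
  define prog where "prog =
    Seq (Assign n (Var 0)) (Seq (Assign (Suc n) (Var 0)) (Seq (cp (Suc n)) (Seq (Assign 0 (Var (Suc n)))
    (Seq (simulate (co (Suc n)) n c) (Seq (Assign (Suc n) (Cons_of (Var 0) (Var n)))
    (Seq (cs (Suc n)) (Assign 0 (Var (Suc n)))))))))"
  \<comment> \<open>For an input of size \<open>k\<close>: \<open>X\<close> bounds the translated
    input, \<open>T\<close> the time of the simulated run, \<open>W\<close> the slowdown per unit of
    time, and \<open>Y\<close> the size of the argument of the postprocessing.\<close>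
  define X where "X = (\<lambda>k. poly pp k)"
  define T where "T = (\<lambda>k. poly p (X k))"
  define W where "W = (\<lambda>k. 2 * k + 8 + poly po (T k + k + 1))"
  define Y where "Y = (\<lambda>k. X k + T k + k + 1)"
  define g where "g = (\<lambda>k. Suc k + (Suc k + (poly pp k + (Suc (X k) + (T k * W k +
    (Suc (2 * Y k) + (poly ps (Y k) + Suc (poly ps (Y k)))))))))"
  have "ispoly g"
    unfolding g_def Y_def W_def T_def X_def by (intro ispoly_intros)
  then obtain g' where g': "\<And>k. g k = poly g' k"
    unfolding ispoly_def by blast
  have main: "triple Q (initial_store x) prog (g (data_size x))
      (\<lambda>s. \<exists>T'. edge_set_code (s 0) T' \<and> good' M T')"
    if M: "feasible_instance M" "instance_code D enc x M" "independence_oracle M Q" for M x Q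
  proof -
    let ?k = "data_size x"
    obtain M' where M': "feasible_instance M'" "instance_code D enc (P x) M'"
        "independence_oracle M' (\<lambda>q. A Q q x)"
      and good: "\<And>y T. \<lbrakk>edge_set_code y T; good M' T\<rbrakk> \<Longrightarrow> \<exists>T'. edge_set_code (S Q y x) T' \<and> good' M T'"
      using red[OF M] by blast
    obtain t s' T0 where run: "run (\<lambda>q. A Q q x) c (initial_store (P x)) t s'"
      and t: "t \<le> poly p (data_size (P x))" and T0: "edge_set_code (s' 0) T0" "good M' T0"
      using c[OF M'] by blast
    have sizeP: "data_size (P x) \<le> X ?k"
      unfolding X_def using computes_size[OF cp order_refl] .
    have tT: "t \<le> T ?k"
      unfolding T_def using t poly_nat_mono[OF sizeP] le_trans by blast
    have sizeY: "data_size (s' 0) + ?k + 1 \<le> Y ?k"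
      using run_data_size[OF run, of 0] sizeP tT by (simp add: Y_def initial_store_def)
    let ?y = "s' 0"
    let ?post = "\<lambda>s. \<exists>T'. edge_set_code (s 0) T' \<and> good' M T'"
    have size_out: "data_size (S Q ?y x) \<le> poly ps (Y ?k)"
      using computes_size[OF cs, of "Pair ?y x" "Y ?k" Q] sizeY by simp
    have 1: "triple Q s (Assign 0 (Var (Suc n))) (Suc (poly ps (Y ?k))) ?post"
      if "s (Suc n) = S Q ?y x" for s
      by (rule triple_Assign) (use that size_out good[OF T0] in auto)
    have 2: "triple Q s (Seq (cs (Suc n)) (Assign 0 (Var (Suc n))))
        (poly ps (Y ?k) + Suc (poly ps (Y ?k))) ?post"
      if "s (Suc n) = Pair ?y x" for s
      by (rule computes_Seq[OF cs], (use that sizeY in simp), rule 1) (use that in simp)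
    have 3: "triple Q s (Seq (Assign (Suc n) (Cons_of (Var 0) (Var n)))
        (Seq (cs (Suc n)) (Assign 0 (Var (Suc n)))))
        (Suc (2 * Y ?k) + (poly ps (Y ?k) + Suc (poly ps (Y ?k)))) ?post"
      if "(\<forall>v<n. s v = s' v) \<and> s n = x" for s
      by (rule triple_Assign_Seq, rule 2) (use that sizeY in \<open>auto simp: n_def\<close>)
    have 4: "triple Q s (Seq (simulate (co (Suc n)) n c) (Seq (Assign (Suc n) (Cons_of (Var 0) (Var n)))
        (Seq (cs (Suc n)) (Assign 0 (Var (Suc n))))))
        (T ?k * W ?k + (Suc (2 * Y ?k) + (poly ps (Y ?k) + Suc (poly ps (Y ?k))))) ?post"
      if "\<forall>v<n. s v = initial_store (P x) v" "s n = x" for s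
    proof (rule triple_Seq[OF triple_weaken 3])
      show "triple Q s (simulate (co (Suc n)) n c) (t * W ?k)
          (\<lambda>s. (\<forall>v<n. s v = s' v) \<and> s n = x)"
        by (rule triple_simulate[OF co run _ tT that]) (simp_all add: n_def W_def)
      show "t * W ?k \<le> T ?k * W ?k"
        using tT by (rule mult_right_mono) simp
    qed
    \<comment> \<open>The algorithm expects all its cells other than 0 to hold \<open>Atom\<close>;
      they do, since the translation only touched cells from \<open>Suc n\<close> on.\<close>
    have 5: "triple Q s (Seq (Assign 0 (Var (Suc n))) (Seq (simulate (co (Suc n)) n c)
        (Seq (Assign (Suc n) (Cons_of (Var 0) (Var n))) (Seq (cs (Suc n)) (Assign 0 (Var (Suc n)))))))
        (Suc (X ?k) + (T ?k * W ?k + (Suc (2 * Y ?k) + (poly ps (Y ?k) + Suc (poly ps (Y ?k)))))) ?post"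
      if "s (Suc n) = P x" "\<And>v. v < Suc n \<Longrightarrow> s v = ((initial_store x)(n := x)) v" for s
    proof (rule triple_Assign_Seq, rule 4)
      show "(s(0 := eval_expr (Var (Suc n)) s)) n = x"
        using that(2)[of n] by (simp add: n_def)
      show "\<forall>v<n. (s(0 := eval_expr (Var (Suc n)) s)) v = initial_store (P x) v"
        using that by (auto simp: initial_store_def)
    qed (use that(1) sizeP in simp)
    show ?thesis
      unfolding prog_def g_def
    proof (rule triple_Assign_Seq, rule triple_Assign_Seq, rule computes_Seq[OF cp _ 5])
    qed (auto simp: initial_store_def n_def)
  qed
  have "\<exists>t s T. run Q prog (initial_store x) t s \<and> t \<le> poly g' (data_size x) \<and>
      edge_set_code (s 0) T \<and> good' M T"
    if "feasible_instance M \<and> instance_code D enc x M \<and> independence_oracle M Q" for M x Q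
    using main[of M x Q] that unfolding triple_def g' by blast
  then show ?thesis
    unfolding polytime_on_feasible_def by blast
qed

section \<open>Programs for the glued instance\<close>

lemma elems_inject: "elems a = elems b \<longleftrightarrow> a = b"
  by (metis list_data_elems)

text \<open>Emitting something for each violation thus tests a universal statement, which is how the
  oracle and the feasibility test form conjunctions.\<close>

lemma flat_map_eq_Atom_iff: "flat_map g d = Atom \<longleftrightarrow> (\<forall>l\<in>set (suffixes d). g l = Atom)"
  by (simp flip: elems_eq_Nil_iff add: elems_flat_map)

lemma set_elems_flat_map_first:
  "set (elems (flat_map (\<lambda>l. g (first l)) d)) = (\<Union>x\<in>set (elems d). set (elems (g x)))"
  by (simp add: elems_flat_map_first)

definition member_data :: "data \<Rightarrow> data \<Rightarrow> bool" where
  "member_data v s \<longleftrightarrow> flat_map (\<lambda>l. if first l = v then Pair Atom Atom else Atom) s \<noteq> Atom"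

lemma member_data_iff: "member_data v s \<longleftrightarrow> v \<in> set (elems s)"
proof -
  have "elems (flat_map (\<lambda>l. if first l = v then Pair Atom Atom else Atom) s) \<noteq> [] \<longleftrightarrow> v \<in> set (elems s)"
    using elems_flat_map_first[of "\<lambda>x. if x = v then Pair Atom Atom else Atom" s] by auto
  then show ?thesis
    by (simp add: member_data_def)
qed

lemma polytime_member_data:
  assumes "polytime_fun F" and "polytime_fun G"
  shows "polytime_pred (\<lambda>Q x. member_data (F Q x) (G Q x))"
  unfolding member_data_def
  by (intro polytime_intros polytime_comp[OF assms(1)] polytime_comp[OF assms(2)])

text \<open>Only the length matters. The exponent \<open>d\<close> is a constant of the program, so
  the recursion becomes \<open>d\<close> nested loops in its text.\<close>

fun power_data :: "data \<Rightarrow> nat \<Rightarrow> data" where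
  "power_data b 0 = Pair Atom Atom"
| "power_data b (Suc d) = flat_map (\<lambda>_. power_data b d) b"

lemma length_power_data: "length (elems (power_data b d)) = length (elems b) ^ d"
  by (induction d) (simp_all add: elems_flat_map length_concat o_def sum_list_triv)

lemma polytime_power_data:
  assumes "polytime_fun F"
  shows "polytime_fun (\<lambda>Q x. power_data (F Q x) d)"
proof (induction d)
  case (Suc d)
  show ?case
    unfolding power_data.simps
    by (intro polytime_flat_map polytime_comp[OF Suc] assms polytime_intros)
qed (simp add: polytime_const)

text \<open>The edge list and the list of node sets in the input serve as unary numbers, so the
  length is the \<open>d\<close>-th power of \<open>c\<close> plus the number of edges plus the
  number of matroids. The non-empty suffixes of this list name the copies.\<close>

definition counter :: "nat \<Rightarrow> nat \<Rightarrow> data \<Rightarrow> data" where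
  "counter c d x =
     power_data (append_data (nat_data c) (append_data (first (second x)) (second (second x)))) d"

lemma polytime_counter:
  assumes "polytime_fun F"
  shows "polytime_fun (\<lambda>Q x. counter c d (F Q x))"
  unfolding counter_def by (intro polytime_power_data polytime_intros assms)

text \<open>The root is common to all copies and is emitted once, outside the loop over the copies;
  otherwise the list would have repetitions.\<close>

definition spread :: "data \<Rightarrow> data \<Rightarrow> data \<Rightarrow> data" where
  "spread r z s = append_data (if member_data r s then Pair Atom Atom else Atom)
     (flat_map (\<lambda>j. flat_map (\<lambda>l. if first l = r then Atom else Pair (Pair j (first l)) Atom) s) z)"

lemma polytime_spread:
  assumes "polytime_fun R" and "polytime_fun Z" and "polytime_fun S"
  shows "polytime_fun (\<lambda>Q x. spread (R Q x) (Z Q x) (S Q x))"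
  unfolding spread_def
  by (intro polytime_member_data polytime_intros polytime_comp[OF assms(1)]
      polytime_comp[OF assms(2)] polytime_comp[OF assms(3)])

lemma polytime_copy:
  assumes "polytime_fun R" and "polytime_fun J" and "polytime_fun V"
  shows "polytime_fun (\<lambda>Q x. copy (R Q x) (J Q x) (V Q x))"
  unfolding copy_def by (intro polytime_intros assms)

lemma polytime_uncopy:
  assumes "polytime_fun R" and "polytime_fun V"
  shows "polytime_fun (\<lambda>Q x. uncopy (R Q x) (V Q x))"
  unfolding uncopy_def by (intro polytime_intros assms)

text \<open>The root is the first listed vertex, \<open>first (first x)\<close>. The encoded cost
  \<open>second (first l)\<close> is carried over as it stands.\<close>

definition glue_data :: "data \<Rightarrow> data \<Rightarrow> data" where
  "glue_data z x = Pair (spread (first (first x)) z (first x))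
     (Pair (flat_map (\<lambda>j. flat_map (\<lambda>l.
              Pair (Pair (Pair (copy (first (first x)) j (first (first (first l))))
                               (copy (first (first x)) j (second (first (first l)))))
                         (second (first l))) Atom) (first (second x))) z)
           (flat_map (\<lambda>l. Pair (spread (first (first x)) z (first l)) Atom) (second (second x))))"

lemma polytime_glue_data:
  assumes "polytime_fun Z" and "polytime_fun X"
  shows "polytime_fun (\<lambda>Q x. glue_data (Z Q x) (X Q x))"
  unfolding glue_data_def
  by (intro polytime_copy polytime_spread polytime_intros polytime_comp[OF assms(1)]
      polytime_comp[OF assms(2)])

text \<open>At most one endpoint of a copied edge is the root \<open>Atom\<close>, so the tag is
  read from the other one when the first carries none.\<close>

definition edge_tag :: "data \<Rightarrow> data" where
  "edge_tag e = (if first e = Atom then first (second e) else first (first e))"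

definition part_data :: "data \<Rightarrow> data \<Rightarrow> data \<Rightarrow> data" where
  "part_data r j y = flat_map (\<lambda>l. if edge_tag (first l) = j
     then Pair (Pair (uncopy r (first (first l))) (uncopy r (second (first l)))) Atom else Atom) y"

lemma polytime_part_data:
  assumes "polytime_fun R" and "polytime_fun J" and "polytime_fun Y"
  shows "polytime_fun (\<lambda>Q x. part_data (R Q x) (J Q x) (Y Q x))"
  unfolding part_data_def edge_tag_def
  by (intro polytime_uncopy polytime_intros polytime_comp[OF assms(1)]
      polytime_comp[OF assms(2)] polytime_comp[OF assms(3)])

definition cut_data :: "data \<Rightarrow> data \<Rightarrow> data" where
  "cut_data s y = flat_map (\<lambda>l. if member_data (first (first l)) s
     then (if member_data (second (first l)) s then Atom else Pair (first l) Atom)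
     else (if member_data (second (first l)) s then Pair (first l) Atom else Atom)) y"

lemma polytime_cut_data:
  assumes "polytime_fun S" and "polytime_fun Y"
  shows "polytime_fun (\<lambda>Q x. cut_data (S Q x) (Y Q x))"
  unfolding cut_data_def
  by (intro polytime_member_data polytime_intros polytime_comp[OF assms(1)]
      polytime_comp[OF assms(2)])

definition glued_oracle :: "data \<Rightarrow> data \<Rightarrow> (data \<Rightarrow> bool) \<Rightarrow> data \<Rightarrow> bool" where
  "glued_oracle r z Q q \<longleftrightarrow> flat_map (\<lambda>j. if Q (Pair (first q) (part_data r j (second q)))
     then Atom else Pair Atom Atom) z = Atom"

lemma polytime_glued_oracle:
  assumes "polytime_fun R" and "polytime_fun Z" and "polytime_fun Y"
  shows "polytime_pred (\<lambda>Q x. glued_oracle (R Q x) (Z Q x) Q (Y Q x))"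
  unfolding glued_oracle_def
  by (intro polytime_part_data polytime_intros polytime_comp[OF assms(1)]
      polytime_comp[OF assms(2)] polytime_comp[OF assms(3)])

text \<open>The node sets are processed from the last to the first: then the index of a node set is the
  number of node sets that still remain.\<close>

definition feasible_data :: "(data \<Rightarrow> bool) \<Rightarrow> data \<Rightarrow> data \<Rightarrow> bool" where
  "feasible_data Q ss y \<longleftrightarrow> flat_map (\<lambda>l.
     if Q (Pair (flat_map (\<lambda>_. Pair Atom Atom) (second l)) (cut_data (first l) y))
     then Atom else Pair Atom Atom) (rev_data ss) = Atom"

lemma polytime_feasible_data:
  assumes "polytime_fun S" and "polytime_fun Y"
  shows "polytime_pred (\<lambda>Q x. feasible_data Q (S Q x) (Y Q x))"
  unfolding feasible_data_def
  by (intro polytime_cut_data polytime_intros polytime_comp[OF assms(1)]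
      polytime_comp[OF assms(2)])

definition select_data :: "data \<Rightarrow> data \<Rightarrow> (data \<Rightarrow> bool) \<Rightarrow> data \<Rightarrow> data \<Rightarrow> data" where
  "select_data r z Q ss y = first (flat_map (\<lambda>j. if feasible_data Q ss (part_data r j y)
     then Pair (part_data r j y) Atom else Atom) z)"

lemma polytime_select_data:
  assumes "polytime_fun R" and "polytime_fun Z" and "polytime_fun S" and "polytime_fun Y"
  shows "polytime_fun (\<lambda>Q x. select_data (R Q x) (Z Q x) Q (S Q x) (Y Q x))"
  unfolding select_data_def
  by (intro polytime_feasible_data polytime_part_data polytime_intros polytime_comp[OF assms(1)]
      polytime_comp[OF assms(2)] polytime_comp[OF assms(3)] polytime_comp[OF assms(4)])

section \<open>Correctness of the programs\<close>

lemma eq_list_dataI: "elems d = xs \<Longrightarrow> d = list_data xs"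
  by auto

text \<open>Every tree is a list, and every tree other than \<open>Atom\<close> is a pair, so being
  a code is a condition on the entries alone. Repetitions and either orientation are
  allowed.\<close>

lemma edge_set_code_iff:
  "edge_set_code y T \<longleftrightarrow>
    (\<forall>p\<in>set (elems y). p \<noteq> Atom) \<and> T = (\<lambda>p. {first p, second p}) ` set (elems y)"
proof
  assume "edge_set_code y T"
  then obtain ps where "y = list_data (map (\<lambda>(u, v). Pair u v) ps)" "T = (\<lambda>(u, v). {u, v}) ` set ps"
    unfolding edge_set_code_def by blast
  then show "(\<forall>p\<in>set (elems y). p \<noteq> Atom) \<and> T = (\<lambda>p. {first p, second p}) ` set (elems y)"
    by (auto simp: image_image case_prod_unfold)
next
  assume *: "(\<forall>p\<in>set (elems y). p \<noteq> Atom) \<and> T = (\<lambda>p. {first p, second p}) ` set (elems y)"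
  have pair: "Pair (first p) (second p) = p" if "p \<in> set (elems y)" for p
    using * that by (cases p) auto
  let ?ps = "map (\<lambda>p. (first p, second p)) (elems y)"
  have "map (\<lambda>(u, v). Pair u v) ?ps = elems y"
    by (simp add: o_def pair cong: map_cong)
  then have "y = list_data (map (\<lambda>(u, v). Pair u v) ?ps)"
    by (metis list_data_elems)
  moreover have "T = (\<lambda>(u, v). {u, v}) ` set ?ps"
    using * by (simp add: image_image)
  ultimately show "edge_set_code y T"
    unfolding edge_set_code_def by blast
qed

lemma edge_tag_copies: "u \<noteq> v \<Longrightarrow> edge_tag (Pair (copy r j u) (copy r j v)) = j"
  by (auto simp: edge_tag_def copy_def)

lemma nat_data_length: "flat_map (\<lambda>_. Pair Atom Atom) d = nat_data (length (elems d))"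
proof -
  have "elems (flat_map (\<lambda>_. Pair Atom Atom) d) = replicate (length (elems d)) Atom"
    by (induction d) (simp_all add: elems_flat_map)
  then show ?thesis
    by (metis nat_data_def elems_list_data elems_inject)
qed

text \<open>A suffix with a tail of length \<open>i\<close> starts at the entry of position
  \<open>i\<close> counted from the end. This recovers the indices without a counter.\<close>

lemma suffixes_index:
  "(\<lambda>l. (length (elems (second l)), first l)) ` set (suffixes d) =
    (\<lambda>i. (i, rev (elems d) ! i)) ` {..<length (elems d)}"
proof (induction d)
  case (Pair h t)
  have eq: "(\<lambda>i. (i, rev (elems t) ! i)) ` {..<length (elems t)} =
      (\<lambda>i. (i, rev (elems (Pair h t)) ! i)) ` {..<length (elems t)}"
    by (rule image_cong) (auto simp: nth_append)
  have "(\<lambda>l. (length (elems (second l)), first l)) ` set (suffixes (Pair h t)) =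
      insert (length (elems t), h) ((\<lambda>i. (i, rev (elems (Pair h t)) ! i)) ` {..<length (elems t)})"
    unfolding eq[symmetric] Pair.IH(2)[symmetric] by simp
  also have "\<dots> = (\<lambda>i. (i, rev (elems (Pair h t)) ! i)) ` {..<Suc (length (elems t))}"
    unfolding lessThan_Suc by (simp add: nth_append)
  finally show ?case
    by simp
qed simp

lemma distinct_concat_map:
  assumes "distinct js" and "distinct xs"
    and "\<And>j j' x x'. \<lbrakk>x \<in> set xs; x' \<in> set xs; g j x = g j' x'\<rbrakk> \<Longrightarrow> j = j' \<and> x = x'"
  shows "distinct (concat (map (\<lambda>j. map (g j) xs) js))"
  using assms(1)
proof (induction js)
  case (Cons j js)
  have "distinct (map (g j) xs)"
    using assms(2,3) by (auto simp: distinct_map inj_on_def)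
  moreover have "set (map (g j) xs) \<inter> set (concat (map (\<lambda>j. map (g j) xs) js)) = {}"
    using assms(3) Cons.prems by fastforce
  ultimately show ?case
    using Cons by simp
qed simp

lemma elems_spread:
  "elems (spread r z s) = (if r \<in> set (elems s) then [Atom] else []) @
    concat (map (\<lambda>j. map (Pair j) (filter (\<lambda>v. v \<noteq> r) (elems s))) (suffixes z))"
proof -
  have "elems (flat_map (\<lambda>l. if first l = r then Atom else Pair (Pair j (first l)) Atom) s) =
      map (Pair j) (filter (\<lambda>v. v \<noteq> r) (elems s))" for j
  proof -
    have "concat (map (\<lambda>x. elems (if x = r then Atom else Pair (Pair j x) Atom)) xs) =
        map (Pair j) (filter (\<lambda>v. v \<noteq> r) xs)" for xs
      by (induction xs) auto
    then show ?thesis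
      using elems_flat_map_first[of "\<lambda>x. if x = r then Atom else Pair (Pair j x) Atom" s] by simp
  qed
  then show ?thesis
    by (simp add: spread_def member_data_iff elems_flat_map)
qed

lemma distinct_spread:
  assumes "distinct (elems s)"
  shows "distinct (elems (spread r z s))"
proof -
  have "distinct (concat (map (\<lambda>j. map (Pair j) (filter (\<lambda>v. v \<noteq> r) (elems s))) (suffixes z)))"
    by (rule distinct_concat_map) (use assms distinct_suffixes in auto)
  then show ?thesis
    by (auto simp: elems_spread)
qed

text \<open>For an empty \<open>z\<close> the root could still be listed although there is no copy;
  otherwise \<open>z\<close> is one of its own suffixes and gives an index for it.\<close>

lemma set_spread:
  assumes "z \<noteq> Atom"
  shows "set (elems (spread r z s)) = (\<Union>j\<in>set (suffixes z). copy r j ` set (elems s))"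
proof -
  have "z \<in> set (suffixes z)"
    using assms by (cases z) auto
  then show ?thesis
    by (auto simp: elems_spread copy_def split: if_splits)
qed

text \<open>The new lists run through the original ones copy by copy. Distinct edges are needed as
  sets of endpoints, not as ordered pairs; this rests on \<open>copy_image_eq\<close> and on the
  distinctness of the suffixes.\<close>

lemma glue_data_code:
  assumes inst: "gmdst_instance M" and code: "instance_code D enc x M" and z: "z \<noteq> Atom"
  shows "instance_code D enc (glue_data z x) (glue (first (first x)) (set (suffixes z)) M)"
proof -
  obtain vs ps ss where costs: "cost M ` edges M \<subseteq> D"
    and vs: "distinct vs" "set vs = verts M"
    and ps: "distinct (map (\<lambda>(u, v). {u, v}) ps)" "(\<lambda>(u, v). {u, v}) ` set ps = edges M"
    and ss: "length ss = num M" "\<forall>i<num M. distinct (ss ! i) \<and> set (ss ! i) = node_set M i"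
    and x: "x = Pair (list_data vs)
              (Pair (list_data (map (\<lambda>(u, v). Pair (Pair u v) (enc (cost M {u, v}))) ps))
                    (list_data (map list_data ss)))"
    using code unfolding instance_code_def by blast
  define r where "r = first (first x)"
  define J where "J = set (suffixes z)"
  let ?G = "glue r J M"
  have card2: "card e = 2" if "e \<in> edges M" for e
    using inst that unfolding gmdst_instance_def simple_graph_def by blast
  define vs' where "vs' = elems (spread r z (list_data vs))"
  define ps' where "ps' = concat (map (\<lambda>j. map (\<lambda>(u, v). (copy r j u, copy r j v)) ps) (suffixes z))"
  define ss' where "ss' = map (\<lambda>s. elems (spread r z (list_data s))) ss"
  have cost_G: "cost ?G {copy r j u, copy r j v} = cost M {u, v}" for j u v
    by (simp add: glue_def)
  have vs': "distinct vs'" "set vs' = verts ?G"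
    using vs distinct_spread[of "list_data vs" r z] set_spread[OF z, of r "list_data vs"]
    by (auto simp: vs'_def glue_def J_def)
  have "map (\<lambda>(u, v). {u, v}) ps' =
      concat (map (\<lambda>j. map (image (copy r j)) (map (\<lambda>(u, v). {u, v}) ps)) (suffixes z))"
    by (simp add: ps'_def map_concat o_def case_prod_unfold)
  moreover have "distinct (concat (map (\<lambda>j. map (image (copy r j)) (map (\<lambda>(u, v). {u, v}) ps)) (suffixes z)))"
  proof (rule distinct_concat_map[OF distinct_suffixes ps(1)])
    fix j j' e e' assume "e \<in> set (map (\<lambda>(u, v). {u, v}) ps)" and eq: "copy r j ` e = copy r j' ` e'"
    then have "e \<in> edges M"
      using ps(2) by simp
    then show "j = j' \<and> e = e'"
      using copy_image_eq[OF card2 eq] by blast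
  qed
  ultimately have ps'1: "distinct (map (\<lambda>(u, v). {u, v}) ps')"
    by simp
  have ps'2: "(\<lambda>(u, v). {u, v}) ` set ps' = edges ?G"
  proof -
    have "(\<lambda>(u, v). {u, v}) ` set ps' =
        (\<Union>j\<in>J. image (copy r j) ` (\<lambda>(u, v). {u, v}) ` set ps)"
      by (simp add: ps'_def J_def image_UN image_image case_prod_unfold)
    then show ?thesis
      by (simp add: ps(2) glue_def)
  qed
  have "glue_data z x = Pair (list_data vs')
        (Pair (list_data (map (\<lambda>(u, v). Pair (Pair u v) (enc (cost ?G {u, v}))) ps'))
              (list_data (map list_data ss')))"
  proof -
    let ?edge = "\<lambda>j p. Pair (Pair (copy r j (first (first p))) (copy r j (second (first p)))) (second p)"
    have "elems (flat_map (\<lambda>j. flat_map (\<lambda>l. Pair (?edge j (first l)) Atom) (first (second x))) z) =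
        concat (map (\<lambda>j. map (?edge j) (elems (first (second x)))) (suffixes z))"
      by (simp add: elems_flat_map concat_map_singleton o_def
          flip: map_first_suffixes[of "first (second x)"])
    also have "\<dots> = map (\<lambda>(u, v). Pair (Pair u v) (enc (cost ?G {u, v}))) ps'"
      by (simp add: x ps'_def map_concat o_def case_prod_unfold cost_G)
    finally have 1: "flat_map (\<lambda>j. flat_map (\<lambda>l. Pair (?edge j (first l)) Atom) (first (second x))) z =
        list_data (map (\<lambda>(u, v). Pair (Pair u v) (enc (cost ?G {u, v}))) ps')"
      by (rule eq_list_dataI)
    have "elems (flat_map (\<lambda>l. Pair (spread r z (first l)) Atom) (second (second x))) =
        map list_data ss'"
      by (simp add: elems_flat_map_first[of "\<lambda>s. Pair (spread r z s) Atom"] x ss'_def o_def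
          concat_map_singleton)
    then have 2: "flat_map (\<lambda>l. Pair (spread r z (first l)) Atom) (second (second x)) =
        list_data (map list_data ss')"
      by (rule eq_list_dataI)
    show ?thesis
      unfolding glue_data_def r_def[symmetric] 1 2 by (simp add: vs'_def x)
  qed
  moreover have "cost ?G ` edges ?G \<subseteq> D"
    using costs by (auto simp: glue_def)
  moreover have "length ss' = num ?G"
    using ss(1) by (simp add: ss'_def glue_def)
  moreover have "\<forall>i<num ?G. distinct (ss' ! i) \<and> set (ss' ! i) = node_set ?G i"
    using ss distinct_spread set_spread[OF z] by (simp add: ss'_def glue_def J_def)
  ultimately show ?thesis
    unfolding instance_code_def r_def[symmetric] J_def[symmetric] using vs' ps'1 ps'2 by blast
qed

context gluing
begin

text \<open>Each listed pair is a copied edge, in some orientation, with both endpoints in the same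
  copy. Its tag therefore decides membership in the part, and removing the tags gives the original
  endpoints.\<close>

lemma part_data_code:
  assumes code: "edge_set_code y R" and R: "R \<subseteq> edges G" and j: "j \<in> J"
  shows "edge_set_code (part_data r j y) (part j R)"
proof -
  have R_eq: "R = (\<lambda>p. {first p, second p}) ` set (elems y)"
    and no_Atom: "\<forall>p\<in>set (elems y). p \<noteq> Atom"
    using code by (auto simp: edge_set_code_iff)
  have dest: "\<exists>j'\<in>J. \<exists>u v. p = Pair (copy r j' u) (copy r j' v) \<and> u \<noteq> v \<and> {u, v} \<in> edges M"
    if p: "p \<in> set (elems y)" for p
  proof -
    obtain a b where ab: "p = Pair a b"
      using no_Atom p by (cases p) auto
    then have "{a, b} \<in> R"
      using p unfolding R_eq by (intro image_eqI[of _ _ p]) auto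
    then obtain j' e where e: "j' \<in> J" "e \<in> edges M" "{a, b} = \<phi> j' e"
      using R by (auto simp: edges_glue)
    then obtain u v where uv: "a = copy r j' u" "b = copy r j' v"
      by (metis imageE insertI1 insert_commute)
    have "\<phi> j' e = \<phi> j' {u, v}"
      using e(3) uv by simp
    then have "e = {u, v}"
      using inj_copy by (metis inj_image_eq_iff)
    moreover from this have "u \<noteq> v"
      using edge_card[OF e(2)] by auto
    ultimately show ?thesis
      using e ab uv by auto
  qed
  have elems: "set (elems (part_data r j y)) =
      (\<lambda>p. Pair (uncopy r (first p)) (uncopy r (second p))) ` {p \<in> set (elems y). edge_tag p = j}"
    unfolding part_data_def set_elems_flat_map_first[of "\<lambda>p. if edge_tag p = j
      then Pair (Pair (uncopy r (first p)) (uncopy r (second p))) Atom else Atom" y]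
    by (auto split: if_splits)
  have "e \<in> (\<lambda>p. {uncopy r (first p), uncopy r (second p)}) ` {p \<in> set (elems y). edge_tag p = j}"
    if e: "e \<in> part j R" for e
  proof -
    have "\<phi> j e \<in> R" "e \<in> edges M"
      using e by (auto simp: slice_def)
    then obtain p where p: "p \<in> set (elems y)" "\<phi> j e = {first p, second p}"
      unfolding R_eq by auto
    then obtain j' u v where uv: "p = Pair (copy r j' u) (copy r j' v)" "u \<noteq> v" "{u, v} \<in> edges M"
      using dest by blast
    have "\<phi> j e = \<phi> j' {u, v}"
      using p(2) uv(1) by simp
    from copy_image_eq[OF edge_card[OF \<open>e \<in> edges M\<close>] this] have "j = j'" "e = {u, v}"
      by simp_all
    then show ?thesis
      using p(1) uv by (intro image_eqI[of _ _ p]) (auto simp: edge_tag_copies)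
  qed
  moreover have "{uncopy r (first p), uncopy r (second p)} \<in> part j R"
    if p: "p \<in> set (elems y)" "edge_tag p = j" for p
  proof -
    obtain j' u v where uv: "p = Pair (copy r j' u) (copy r j' v)" "u \<noteq> v" "{u, v} \<in> edges M"
      using dest[OF p(1)] by blast
    then have "j' = j"
      using p(2) edge_tag_copies by simp
    moreover have "{first p, second p} \<in> R"
      using p(1) by (auto simp: R_eq)
    ultimately show ?thesis
      using uv by (simp add: slice_def)
  qed
  ultimately have "part j R =
      (\<lambda>p. {uncopy r (first p), uncopy r (second p)}) ` {p \<in> set (elems y). edge_tag p = j}"
    by blast
  then show ?thesis
    by (auto simp: edge_set_code_iff elems image_image)
qed

text \<open>\<open>Q\<close> is reliable only on subsets of the cut with the given index; the slices
  of a subset of the glued cut are such sets. Gluing keeps the numbering, so the index is passed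
  through.\<close>

lemma glued_oracle_correct:
  assumes oracle_Q: "independence_oracle M Q" and J: "J = set (suffixes z)"
  shows "independence_oracle G (glued_oracle r z Q)"
  unfolding independence_oracle_def num_glue
proof (intro allI impI)
  fix i R y assume i: "i < num M" and R: "R \<subseteq> delta G i" and y: "edge_set_code y R"
  have R_edges: "R \<subseteq> edges G"
    using R by (auto simp: delta_def cut_def)
  have part: "slice \<phi> (delta M i) j R = part j R" "part j R \<subseteq> delta M i" if "j \<in> J" for j
  proof -
    have "R \<inter> delta G i = R"
      using R by blast
    moreover have sub: "part j R \<subseteq> delta M i"
      using R delta_glue_iff[OF that] by (auto simp: slice_def)
    ultimately show "slice \<phi> (delta M i) j R = part j R" "part j R \<subseteq> delta M i"
      using slice_delta[OF that, of i R] by auto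
  qed
  have "glued_oracle r z Q (Pair (nat_data i) y) \<longleftrightarrow>
      (\<forall>j\<in>J. Q (Pair (nat_data i) (part_data r j y)))"
    by (simp add: glued_oracle_def flat_map_eq_Atom_iff J)
  also have "\<dots> \<longleftrightarrow> (\<forall>j\<in>J. part j R \<in> indep M i)"
  proof (intro ball_cong refl)
    fix j assume j: "j \<in> J"
    show "Q (Pair (nat_data i) (part_data r j y)) = (part j R \<in> indep M i)"
      using oracle_Q i part(2)[OF j] part_data_code[OF y R_edges j]
      unfolding independence_oracle_def by blast
  qed
  also have "\<dots> \<longleftrightarrow> R \<in> indep G i"
    using R part(1) by (simp add: indep_glue sum_indep_def delta_glue)
  finally show "glued_oracle r z Q (Pair (nat_data i) y) = (R \<in> indep G i)" .
qed

end

text \<open>Since an edge has two distinct endpoints, meeting the node set in exactly one node is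
  the exclusive disjunction that the program tests.\<close>

lemma cut_data_code:
  assumes inst: "gmdst_instance M" and code: "edge_set_code y T" and T: "T \<subseteq> edges M"
    and s: "set (elems s) = node_set M i"
  shows "edge_set_code (cut_data s y) (T \<inter> delta M i)"
proof -
  have T_eq: "T = (\<lambda>p. {first p, second p}) ` set (elems y)"
    and no_Atom: "\<forall>p\<in>set (elems y). p \<noteq> Atom"
    using code by (auto simp: edge_set_code_iff)
  let ?S = "node_set M i"
  have elems: "set (elems (cut_data s y)) =
      {p \<in> set (elems y). (first p \<in> ?S) \<noteq> (second p \<in> ?S)}"
    unfolding cut_data_def set_elems_flat_map_first[of "\<lambda>p. if member_data (first p) s
     then (if member_data (second p) s then Atom else Pair p Atom)
     else (if member_data (second p) s then Pair p Atom else Atom)" y]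
    by (auto simp: member_data_iff s split: if_splits)
  have "{first p, second p} \<in> delta M i \<longleftrightarrow> (first p \<in> ?S) \<noteq> (second p \<in> ?S)"
    if p: "p \<in> set (elems y)" for p
  proof -
    have e: "{first p, second p} \<in> edges M"
      using p T by (auto simp: T_eq)
    then have "card {first p, second p} = 2"
      using inst unfolding gmdst_instance_def simple_graph_def by blast
    then have "first p \<noteq> second p"
      by auto
    then have "card ({first p, second p} \<inter> ?S) = 1 \<longleftrightarrow> (first p \<in> ?S) \<noteq> (second p \<in> ?S)"
      by (cases "first p \<in> ?S"; cases "second p \<in> ?S") auto
    then show ?thesis
      using e by (simp add: delta_def cut_def)
  qed
  then have "T \<inter> delta M i = (\<lambda>p. {first p, second p}) ` set (elems (cut_data s y))"
    by (auto simp: T_eq elems)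
  then show ?thesis
    using no_Atom by (auto simp: edge_set_code_iff elems)
qed

text \<open>Only independence has to be tested: the candidates are parts of a spanning tree of the
  glued graph, hence spanning trees by \<open>spanning_tree_part\<close>.\<close>

lemma feasible_data_iff:
  assumes inst: "gmdst_instance M" and oracle_Q: "independence_oracle M Q"
    and code: "edge_set_code y T" and T: "T \<subseteq> edges M"
    and ss: "length ss = num M" "\<forall>i<num M. set (ss ! i) = node_set M i"
  shows "feasible_data Q (list_data (map list_data ss)) y \<longleftrightarrow> (\<forall>i<num M. T \<inter> delta M i \<in> indep M i)"
proof -
  let ?L = "rev_data (list_data (map list_data ss))"
  have "feasible_data Q (list_data (map list_data ss)) y \<longleftrightarrow>
      (\<forall>l\<in>set (suffixes ?L). Q (Pair (nat_data (length (elems (second l)))) (cut_data (first l) y)))"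
    by (simp add: feasible_data_def flat_map_eq_Atom_iff nat_data_length)
  also have "\<dots> \<longleftrightarrow> (\<forall>(i, s)\<in>(\<lambda>l. (length (elems (second l)), first l)) ` set (suffixes ?L).
      Q (Pair (nat_data i) (cut_data s y)))"
    by simp
  also have "\<dots> \<longleftrightarrow> (\<forall>i<num M. Q (Pair (nat_data i) (cut_data (list_data (ss ! i)) y)))"
    unfolding suffixes_index using ss(1) by auto
  also have "\<dots> \<longleftrightarrow> (\<forall>i<num M. T \<inter> delta M i \<in> indep M i)"
  proof (intro all_cong)
    fix i assume i: "i < num M"
    have "edge_set_code (cut_data (list_data (ss ! i)) y) (T \<inter> delta M i)"
      by (rule cut_data_code[OF inst code T]) (use ss i in simp)
    then show "Q (Pair (nat_data i) (cut_data (list_data (ss ! i)) y)) = (T \<inter> delta M i \<in> indep M i)"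
      using oracle_Q i unfolding independence_oracle_def by blast
  qed
  finally show ?thesis .
qed

text \<open>The emitted candidates are codes of exactly the feasible parts, and a feasible part
  exists, so the list has a first entry and any entry will do.\<close>

lemma (in gluing) select_data_correct:
  assumes oracle_Q: "independence_oracle M Q" and J: "J = set (suffixes z)"
    and code: "edge_set_code y T" and T: "spanning_tree (verts G) (edges G) T"
    and ss: "length ss = num M" "\<forall>i<num M. set (ss ! i) = node_set M i"
    and ex: "\<exists>j\<in>J. feasible_solution M (part j T)"
  shows "\<exists>T'. edge_set_code (select_data r z Q (list_data (map list_data ss)) y) T' \<and> feasible_solution M T'"
proof -
  have T_edges: "T \<subseteq> edges G"
    using T by (simp add: spanning_tree_def)
  have feas: "feasible_data Q (list_data (map list_data ss)) (part_data r j y) \<longleftrightarrow>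
      feasible_solution M (part j T)" if "j \<in> J" for j
    using feasible_data_iff[OF inst oracle_Q part_data_code[OF code T_edges that] _ ss]
      spanning_tree_part[OF T that]
    by (simp add: feasible_solution_def spanning_tree_def)
  define C where "C = flat_map (\<lambda>j. if feasible_data Q (list_data (map list_data ss)) (part_data r j y)
     then Pair (part_data r j y) Atom else Atom) z"
  have "set (elems C) = (\<lambda>j. part_data r j y) ` {j \<in> J. feasible_solution M (part j T)}"
    unfolding C_def using feas by (auto simp: elems_flat_map J split: if_splits)
  moreover from this have "first C \<in> set (elems C)"
    using ex by (cases C) auto
  ultimately obtain j where "j \<in> J" "feasible_solution M (part j T)" "first C = part_data r j y"
    by auto
  then show ?thesis
    using part_data_code[OF code T_edges] unfolding select_data_def C_def by metis
qed

section \<open>The number of copies\<close>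

text \<open>With \<open>b = c + m + k\<close> and \<open>N = b ^ d\<close>, the decay by a power of
  \<open>N * m\<close> gains a factor of at least \<open>b ^ 3\<close> over the linear bound
  \<open>C * N * m\<close>, and this exceeds \<open>k * C * m\<close> because \<open>C\<close> and
  \<open>m\<close> are at most \<open>b\<close> and \<open>k\<close> is smaller than
  \<open>b\<close>.\<close>

lemma enough_copies:
  fixes f :: "nat \<Rightarrow> real"
  assumes "\<epsilon> > 0" and "f \<in> O(\<lambda>n. real n powr (1 - \<epsilon>))"
  obtains c d where "0 < c"
    and "\<And>k m. 0 < m \<Longrightarrow> real k * f ((c + m + k) ^ d * m) < real ((c + m + k) ^ d)"
proof -
  obtain C where C: "C > 0"
    and ev: "eventually (\<lambda>n. norm (f n) \<le> C * norm (real n powr (1 - \<epsilon>))) at_top"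
    using landau_o.bigE[OF assms(2)] by blast
  obtain n0 where n0: "\<And>n. n \<ge> n0 \<Longrightarrow> norm (f n) \<le> C * norm (real n powr (1 - \<epsilon>))"
    using ev unfolding eventually_sequentially by blast
  \<comment> \<open>Weakening \<epsilon> to \<open>1 / K\<close> with an integer \<open>K\<close>
    makes the root exact: \<open>N = b ^ (3 * K)\<close> has \<open>K\<close>-th root
    \<open>b ^ 3\<close>.\<close>
  obtain K :: nat where K: "1 / \<epsilon> < real K"
    using reals_Archimedean2 by blast
  have K0: "real K > 0"
    using K assms(1) by (meson less_trans zero_less_divide_1_iff)
  have K_le: "1 / real K \<le> \<epsilon>"
    using K K0 assms(1) by (simp add: field_simps)
  \<comment> \<open>The summands make \<open>b\<close> at least the threshold \<open>n0\<close> and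
    the constant \<open>C\<close>, and strictly larger than \<open>k\<close>.\<close>
  define c where "c = n0 + nat \<lceil>C\<rceil> + 1"
  define d where "d = 3 * K"
  show ?thesis
  proof (rule that)
    show "0 < c"
      by (simp add: c_def)
    fix k m :: nat assume m: "0 < m"
    define b where "b = c + m + k"
    define N where "N = b ^ d"
    have b: "1 \<le> b" "real k < real b" "real m \<le> real b"
      by (auto simp: b_def c_def)
    have Cb: "C \<le> real b"
      using real_nat_ceiling_ge[of C] by (simp add: b_def c_def)
    have "b \<le> N"
      unfolding N_def by (rule self_le_power) (use b K0 in \<open>auto simp: d_def\<close>)
    then have n: "n0 \<le> N * m" "1 \<le> N * m" "0 < N"
      using m b(1) by (auto simp: b_def c_def intro: le_trans[of _ N "N * m"])
    have "real N powr (1 / real K) = real b ^ 3"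
    proof -
      have "real N = real b powr (3 * real K)"
        using b(1) by (simp add: N_def d_def powr_realpow[symmetric])
      then have "real N powr (1 / real K) = real b powr 3"
        using K0 by (simp add: powr_powr)
      then show ?thesis
        using b(1) by (simp add: powr_numeral)
    qed
    moreover have "real N powr (1 / real K) \<le> real (N * m) powr (1 / real K)"
      by (rule powr_mono2) (use K0 m in \<open>simp_all del: of_nat_mult\<close>)
    ultimately have root: "real b ^ 3 \<le> real (N * m) powr (1 / real K)"
      by simp
    have n1: "1 \<le> real (N * m)"
      using n(2) by (simp del: of_nat_mult)
    have "f (N * m) \<le> C * real (N * m) powr (1 - \<epsilon>)"
      using n0[OF n(1)] by simp
    also have "\<dots> \<le> C * real (N * m) powr (1 - 1 / real K)"
      by (intro mult_left_mono powr_mono) (use C n1 K_le in \<open>auto simp del: of_nat_mult\<close>)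
    also have "real (N * m) powr (1 - 1 / real K) = real (N * m) / real (N * m) powr (1 / real K)"
      using n by (simp add: powr_diff)
    also have "C * \<dots> \<le> C * (real (N * m) / real b ^ 3)"
      by (intro mult_left_mono divide_left_mono root) (use C n b in auto)
    finally have f: "f (N * m) \<le> C * (real (N * m) / real b ^ 3)" .
    have "real k * (C * real m) \<le> real k * (real b * real b)"
      by (intro mult_left_mono mult_mono) (use C Cb b in auto)
    also have "\<dots> < real b * (real b * real b)"
      using b by (intro mult_strict_right_mono) auto
    finally have kCm: "real k * (C * real m) < real b ^ 3"
      by (simp add: power3_eq_cube)
    have "real k * f (N * m) \<le> real k * (C * (real (N * m) / real b ^ 3))"
      by (intro mult_left_mono f) auto
    also have "\<dots> = real N * (real k * (C * real m) / real b ^ 3)"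
      by simp
    also have "\<dots> < real N * 1"
      by (intro mult_strict_left_mono) (use kCm n b in auto)
    finally show "real k * f ((c + m + k) ^ d * m) < real ((c + m + k) ^ d)"
      by (simp add: N_def b_def)
  qed
qed

theorem theorem6:
  fixes f :: "nat \<Rightarrow> real" and \<epsilon> :: real
    and D :: "real set" and enc :: "real \<Rightarrow> data"
  assumes "\<epsilon> > 0"
    and "f \<in> O(\<lambda>n. real n powr (1 - \<epsilon>))"
    and "inj_on enc D"
    and "polytime_on_feasible D enc (approx_solution f)"
  shows "polytime_on_feasible D enc feasible_solution"
proof -
  obtain c d where c: "0 < c"
    and few: "\<And>k m. 0 < m \<Longrightarrow> real k * f ((c + m + k) ^ d * m) < real ((c + m + k) ^ d)"
    by (rule enough_copies[OF assms(1,2)]) (rule that)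
  \<comment> \<open>All three stages recompute the names of the copies from the original input, so
    nothing else has to be stored.\<close>
  let ?P = "\<lambda>x. glue_data (counter c d x) x"
  let ?A = "\<lambda>Q q x. glued_oracle (first (first x)) (counter c d x) Q q"
  let ?S = "\<lambda>Q y x. select_data (first (first x)) (counter c d x) Q (second (second x)) y"
  show ?thesis
  proof (rule polytime_reduction[OF assms(4), where P = ?P and A = ?A and S = ?S])
    show "polytime_fun (\<lambda>Q. ?P)"
      by (intro polytime_glue_data polytime_counter polytime_id)
    show "polytime_pred (\<lambda>Q z. ?A Q (first z) (second z))"
      by (intro polytime_glued_oracle polytime_counter polytime_intros)
    show "polytime_fun (\<lambda>Q z. ?S Q (first z) (second z))"
      by (intro polytime_select_data polytime_counter polytime_intros)
    fix M x Q
    assume M: "feasible_instance M" and code: "instance_code D enc x M"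
      and oracle_Q: "independence_oracle M Q"
    have inst: "gmdst_instance M"
      using M by (simp add: feasible_instance_def)
    obtain vs ps ss where vs: "set vs = verts M"
      and ps: "distinct (map (\<lambda>(u, v). {u, v}) ps)" "(\<lambda>(u, v). {u, v}) ` set ps = edges M"
      and ss: "length ss = num M" "\<forall>i<num M. set (ss ! i) = node_set M i"
      and x: "x = Pair (list_data vs)
              (Pair (list_data (map (\<lambda>(u, v). Pair (Pair u v) (enc (cost M {u, v}))) ps))
                    (list_data (map list_data ss)))"
      using code unfolding instance_code_def by blast
    define r where "r = first (first x)"
    define z where "z = counter c d x"
    define J where "J = set (suffixes z)"
    \<comment> \<open>The vertex set of a graph is non-empty, so the first listed vertex exists and
      can be the root.\<close>
    have "vs \<noteq> []"
      using inst vs unfolding gmdst_instance_def simple_graph_def by auto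
    then have "r \<in> verts M"
      unfolding r_def x vs[symmetric] by (cases vs) auto
    have "length ps = card (edges M)"
      using distinct_card[OF ps(1)] ps(2) by simp
    then have len: "length (elems z) = (c + card (edges M) + num M) ^ d"
      by (simp add: z_def counter_def length_power_data x nat_data_def ss(1) add.assoc)
    then have "z \<noteq> Atom"
      using c by auto
    have card_J: "card J = (c + card (edges M) + num M) ^ d"
      unfolding J_def distinct_card[OF distinct_suffixes] by (simp add: len)
    interpret gluing M r J
    proof
      show "J \<noteq> {}"
        using card_J c by auto
    qed (use inst \<open>r \<in> verts M\<close> in \<open>auto simp: J_def\<close>)
    obtain T0 where "feasible_solution M T0"
      using M unfolding feasible_instance_def by blast
    then have "feasible_instance G"
      by (rule feasible_glue)
    moreover have "instance_code D enc (?P x) G"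
      using glue_data_code[OF inst code \<open>z \<noteq> Atom\<close>] by (simp add: r_def J_def z_def)
    moreover have "independence_oracle G (\<lambda>q. ?A Q q x)"
      using glued_oracle_correct[OF oracle_Q J_def] by (simp add: r_def z_def)
    moreover have "\<exists>T'. edge_set_code (?S Q y x) T' \<and> feasible_solution M T'"
      if "edge_set_code y T" "approx_solution f G T" for y T
    proof -
      \<comment> \<open>The bound on the number of copies requires \<open>m > 0\<close>, so a graph
        without edges falls under the first alternative.\<close>
      have "edges M = {} \<or> real (num M) * f (card J * card (edges M)) < real (card J)"
        using few[of "card (edges M)" "num M"] finite_edges unfolding card_J
        by (auto simp: card_gt_0_iff)
      then have "\<exists>j\<in>J. feasible_solution M (part j T)"
        by (rule some_part_feasible[OF that(2)])
      moreover have "spanning_tree (verts G) (edges G) T"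
        using that(2) by (simp add: approx_solution_def)
      ultimately show ?thesis
        using select_data_correct[OF oracle_Q J_def that(1) _ ss] by (simp add: x r_def z_def)
    qed
    ultimately show "\<exists>M'. feasible_instance M' \<and> instance_code D enc (?P x) M' \<and>
        independence_oracle M' (\<lambda>q. ?A Q q x) \<and>
        (\<forall>y T. edge_set_code y T \<and> approx_solution f M' T \<longrightarrow>
          (\<exists>T'. edge_set_code (?S Q y x) T' \<and> feasible_solution M T'))"
      by blast
  qed
qed

end
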